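(* Let $\hat\theta_k$ be generated by the randomized-subvector-selection algorithm described in the context. Assume: (A0') $a_k>0$, $a_k^{(j)}>0$, $\sum_{k=0}^\infty a_k=\infty$, $\sum_{k=0}^\infty a_k^2<\infty$. The sequences $\{a_k\}$ and $\{a_k^{(j)}\}$ are strictly monotonically decreasing and $a_k^{(j)}\to0$ for each $j$. There are a function $\rho:\{1,\dots,d\}\times[0,1]\to\mathbb R$, a constant $C<\infty$, and $\epsilon_0>0$ with $q(j)-\epsilon_0>0$ and $q(j)+\epsilon_0\le1$ for all $j$, such that for all $j$ and all $0<\epsilon\le\epsilon_0$: $\lim_{k\to\infty}a^{(j)}_{\lfloor k(q(j)-\epsilon)\rfloor}/a_k=\rho(j,q(j)-\epsilon)$, $\lim_{k\to\infty}a^{(j)}_{\lceil k(q(j)+\epsilon)\rceil}/a_k=\rho(j,q(j)+\epsilon)$, $0<\rho(j,q(j)\pm\epsilon)<C$, and $\lim_{\epsilon\to0}\rho(j,q(j)\pm\epsilon)=\rho(j,q(j))\in[\rho(j,q(j)+\epsilon),\rho(j,q(j)-\epsilon)]$. For some $0<\epsilon\le\epsilon_0$, $e^{-2\epsilon^2k}/a_k\to0$ as $k\to\infty$. Also $0<\rho(j,q(j))<\infty$. (A3') $g$ is continuous. (A4') There are $\Omega_1\subset\Omega$ with $P(\Omega_1)=1$ and $0<R_1(\omega)<\infty$ such that for $\omega\in\Omega_1$ the set $\{\hat\theta_k\}_{k\ge0}$ is contained in the ball of radius $R_1(\omega)$ centered at the origin. (A5') There are $\Omega_2\subset\Omega$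 with $P(\Omega_2)=1$ and $0<R_2(\omega)<\infty$ such that for $\omega\in\Omega_2$ the set $\{\beta_k^{(j_k)}(\hat\theta_k)\}_{k\ge0}$ is contained in the ball of radius $R_2(\omega)$ centered at the origin; and $\beta_k^{(j_k)}(\hat\theta_k)\to0$ w.p.1. (A6') With $D_r=(\tilde a_r^{(j_r)}/a_r)\,\xi_r^{(j_r)}(\hat\theta_r)$, for every $\varepsilon>0$, $\lim_{k\to\infty}P\big(\sup_{m\ge k}\|\sum_{r=k}^ma_rD_r\|\ge\varepsilon\big)=0$. (A7') $\theta^*$ is a locally asymptotically stable (in the sense of Lyapunov) solution of the differential equation $$\dot Z(t)=-\sum_{j=1}^dq(j)\rho(j,q(j))\,g^{(j)}(Z(t)),$$ with domain of attraction $DA(\theta^* )$. (A8') There is a compact subset $A$ of $DA(\theta^* )$ such that $\hat\theta_k\in A$ infinitely often (w.p.1). Then $\hat\theta_k\to\theta^*$ w.p.1.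
   Context: w.p.1 means with probability one; $\|\cdot\|$ is the Euclidean norm; all random quantities live on a probability space $(\Omega,\mathcal F,P)$. $L:\mathbb R^p\to\mathbb R$ is a differentiable loss function with gradient $g$. $\mathcal S_1,\dots,\mathcal S_d\subset\{1,\dots,p\}$ satisfy $\bigcup_{i=1}^d\mathcal S_i=\{1,\dots,p\}$ and $\bigcap_{i=1}^d\mathcal S_i=\emptyset$. For $v\in\mathbb R^p$, $v^{(j)}\in\mathbb R^p$ has $i$th entry $v_i$ if $i\in\mathcal S_j$ and $0$ otherwise. A noisy gradient measurement is written $\hat g_k(\theta)=g(\theta)+\beta_k(\theta)+\xi_k(\theta)$, where (at the points where it is evaluated) $\beta_k(\theta)=E[\hat g_k(\theta)-g(\theta)\mid\mathcal F_k]$, $\xi_k(\theta)=\hat g_k(\theta)-E[\hat g_k(\theta)\mid\mathcal F_k]$, and $\mathcal F_k$ is some representation of the history of the process. Algorithm (randomized subvector selection). Given $\hat\theta_0$ and deterministic gain sequences $\{a_k^{(j)}\}_{k\ge0}$, $j=1,\dots,d$ ($\{a_k\}_{k\ge0}$ is a further deterministic sequence used only in the analysis). The indices $j_0,j_1,\dots$ are independent with $P(j_k=j)=q(j)\ne0$, $\sum_{j=1}^dq(j)=1$. For $k\ge0$, $\hat\theta_{k+1}=\hat\theta_k-\tilde a_k^{(j_k)}\hat g_k^{(j_k)}(\hat\theta_k)$, where $\tilde a_k^{(j)}=a^{(j)}_{N}$ with $N$ the number of $i\in\{0,\dots,k-1\}$ with $j_i=j$ (the first unused element of $\{a_i^{(j)}\}_{i\ge0}$).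 *)

theory Defs
  imports "HOL-Probability.Probability"
begin

definition subvec :: "'p set \<Rightarrow> real ^ 'p \<Rightarrow> real ^ 'p::finite" where
  "subvec S v = (\<chi> i. if i \<in> S then v $ i else 0)"

definition next_gain :: "(nat \<Rightarrow> nat \<Rightarrow> real) \<Rightarrow> (nat \<Rightarrow> nat) \<Rightarrow> nat \<Rightarrow> nat \<Rightarrow> real" where
  "next_gain a js k j = a j (card {i. i < k \<and> js i = j})"

text \<open>
  \<open>Y\<close> is a version of the conditional expectation of the random vector \<open>X\<close> given the sub-sigma-algebra
  \<open>F\<close>. The second conjunct is the existence of the conditional expectation; it holds for every
  integrable \<open>X\<close>, and excludes the default values that the total function \<^const>\<open>real_cond_exp\<close>
  takes when the expectation does not exist.
\<close>

definition is_cond_exp ::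
    "'w measure \<Rightarrow> 'w measure \<Rightarrow> ('w \<Rightarrow> real ^ 'p::finite) \<Rightarrow> ('w \<Rightarrow> real ^ 'p) \<Rightarrow> bool" where
  "is_cond_exp M F X Y \<longleftrightarrow>
     X \<in> borel_measurable M \<and>
     (AE \<omega> in M. nn_cond_exp M F (\<lambda>\<omega>. ennreal (norm (X \<omega>))) \<omega> < \<infinity>) \<and>
     Y \<in> borel_measurable F \<and>
     (AE \<omega> in M. \<forall>i. Y \<omega> $ i = real_cond_exp M F (\<lambda>\<omega>. X \<omega> $ i) \<omega>)"

text \<open>
  The right-hand side is not assumed to be Lipschitz, so solutions need be neither unique nor global.
  A solution lives on \<open>[0, T)\<close> with \<open>0 < T \<le> \<infinity>\<close>; the derivative at \<open>0\<close> is one-sided. The notions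
  below quantify over all solutions with a given initial value.
\<close>

definition ode_solution ::
    "('a::real_normed_vector \<Rightarrow> 'a) \<Rightarrow> ereal \<Rightarrow> (real \<Rightarrow> 'a) \<Rightarrow> bool" where
  "ode_solution f T Z \<longleftrightarrow>
     0 < T \<and> (\<forall>t\<ge>0. ereal t < T \<longrightarrow> (Z has_vector_derivative f (Z t)) (at t within {0..}))"

text \<open>
  Every solution starting at \<open>x\<close> can be continued to all of \<open>[0, \<infinity>)\<close> and then converges to \<open>z\<close>:
  for \<open>T = \<infinity>\<close> the extension \<open>Z'\<close> below coincides with \<open>Z\<close> on \<open>[0, \<infinity>)\<close>.
\<close>

definition domain_of_attraction ::
    "('a::real_normed_vector \<Rightarrow> 'a) \<Rightarrow> 'a \<Rightarrow> 'a set" where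
  "domain_of_attraction f z =
     {x. (\<exists>Z. ode_solution f \<infinity> Z \<and> Z 0 = x) \<and>
         (\<forall>T Z. ode_solution f T Z \<and> Z 0 = x \<longrightarrow>
            (\<exists>Z'. ode_solution f \<infinity> Z' \<and> (\<forall>t\<ge>0. ereal t < T \<longrightarrow> Z' t = Z t) \<and>
                  (Z' \<longlongrightarrow> z) at_top))}"

definition lyapunov_stable :: "('a::real_normed_vector \<Rightarrow> 'a) \<Rightarrow> 'a \<Rightarrow> bool" where
  "lyapunov_stable f z \<longleftrightarrow>
     (\<forall>\<epsilon>>0. \<exists>\<delta>>0. \<forall>T Z. ode_solution f T Z \<and> dist (Z 0) z < \<delta> \<longrightarrow>
        (\<forall>t\<ge>0. ereal t < T \<longrightarrow> dist (Z t) z < \<epsilon>))"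

definition locally_asymptotically_stable ::
    "('a::real_normed_vector \<Rightarrow> 'a) \<Rightarrow> 'a \<Rightarrow> bool" where
  "locally_asymptotically_stable f z \<longleftrightarrow>
     ode_solution f \<infinity> (\<lambda>_. z) \<and> lyapunov_stable f z \<and>
     (\<exists>\<eta>>0. ball z \<eta> \<subseteq> domain_of_attraction f z)"

end

theory Submission
  imports Defs "HOL-Complex_Analysis.Great_Picard"
begin

text \<open>
  The proof is the ODE method applied to a single path \<open>\<omega>\<close>. Measure time so that step \<open>k\<close> takes time
  \<open>a k\<close>. Three facts hold almost surely.

  \<^item> The ratio of the gain used for block \<open>j\<close> to \<open>a k\<close> tends to \<open>\<rho> j (q j)\<close>. By the strong law of large
    numbers about \<open>k * q j\<close> elements of the \<open>j\<close>th gain sequence have been used up before step \<open>k\<close>, and the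
    hypotheses on \<open>\<rho>\<close> together with monotonicity do the rest (\<open>gain_ratio_tendsto\<close>).
  \<^item> The series of \<open>a k * (1[J k = j] - q j)\<close> converges. This is Kolmogorov's criterion for independent
    centred terms with summable variances (\<open>Kolmogorov_convergence_criterion\<close>). Hence over every
    time window of bounded length block \<open>j\<close> receives the share \<open>q j\<close> of the gain, up to an error that
    vanishes as the window moves to infinity.
  \<^item> The series of the noise increments converges, because its tails are small in probability uniformly in
    the upper end of the sum (\<open>AE_summable_if_tails_vanish\<close>).

  On such a path the iterates, corrected by the convergent tail of the noise, are Lipschitz in time.
  Restarting the path at steps tending to infinity therefore gives limits along subsequences
  (\<open>shift_limit_exists\<close>), and a limit is a solution of the averaged differential equation: over
  a short window the state is almost constant, so only the share of each block matters
  (\<open>shift_limit_increment\<close>). Solutions need not be unique; all that is used about the limits is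
  that stability and attraction hold for every solution.

  Restarting at visits to the compact set \<open>A\<close> yields a solution that converges to the equilibrium, so the
  iterates come arbitrarily close to it infinitely often. Restarting at the beginnings of
  excursions away from it contradicts stability (\<open>perturbed_recursion.converges\<close>).
\<close>

section \<open>Recursions that follow a differential equation\<close>

lemma solution_tendsto:
  assumes "ode_solution f \<infinity> Z" "Z 0 \<in> domain_of_attraction f z"
  shows "(Z \<longlongrightarrow> z) at_top"
proof -
  obtain Z' where Z': "\<forall>t\<ge>0. Z' t = Z t" "(Z' \<longlongrightarrow> z) at_top"
    using assms unfolding domain_of_attraction_def by fastforce
  have "eventually (\<lambda>t. Z' t = Z t) at_top"
    using eventually_ge_at_top[of 0] by eventually_elim (use Z' in auto)
  then show ?thesis using Z'(2) by (rule Lim_transform_eventually[rotated])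
qed

text \<open>
  A recursion driven by \<open>I\<close>-indexed vector fields \<open>h j\<close> that are switched by the weights \<open>w k j\<close>. In the
  application \<open>w k j\<close> is the indicator of the event that block \<open>j\<close> is selected at step \<open>k\<close>, so no single
  step resembles a step along the mean field \<open>\<Sum>j\<in>I. q j *\<^sub>R h j\<close>. Convergence of the series in
  \<open>w_average\<close> makes the weights average to \<open>q j\<close> over every window of bounded total gain. The errors
  \<open>r\<close> vanish, whereas the noise increments \<open>e\<close> (which include their gain) need only have convergent
  sums. Everything concerns a single path.
\<close>

locale perturbed_recursion =
  fixes a :: "nat \<Rightarrow> real" and I :: "'j set" and w :: "nat \<Rightarrow> 'j \<Rightarrow> real" and q :: "'j \<Rightarrow> real"
    and h :: "'j \<Rightarrow> 'a \<Rightarrow> 'a::euclidean_space" and r e x :: "nat \<Rightarrow> 'a"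
  assumes a_pos: "a k > 0"
    and a_lim: "a \<longlonglongrightarrow> 0"
    and a_sum: "filterlim (\<lambda>n. \<Sum>k<n. a k) at_top sequentially"
    and finite_I: "finite I"
    and w_bound: "j \<in> I \<Longrightarrow> \<bar>w k j\<bar> \<le> 1"
    and w_average: "j \<in> I \<Longrightarrow> summable (\<lambda>k. a k * (w k j - q j))"
    and h_cont: "j \<in> I \<Longrightarrow> continuous_on UNIV (h j)"
    and r_lim: "r \<longlonglongrightarrow> 0"
    and e_summable: "summable e"
    and x_bounded: "bounded (range x)"
    and x_Suc: "x (Suc k) = x k + a k *\<^sub>R ((\<Sum>j\<in>I. w k j *\<^sub>R h j (x k)) + r k) + e k"
begin

text \<open>
  The time scale of the ODE: step \<open>k\<close> takes time \<open>a k\<close>, and \<open>idx s\<close> is the step under way at time \<open>s\<close>.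
\<close>

definition t :: "nat \<Rightarrow> real" where "t n = (\<Sum>k<n. a k)"

definition idx :: "real \<Rightarrow> nat" where "idx s = (LEAST n. s < t (Suc n))"

definition v :: "nat \<Rightarrow> 'a" where "v n = (\<Sum>j\<in>I. w n j *\<^sub>R h j (x n)) + r n"

text \<open>
  The iterates corrected by the noise still to come. The noise cancels from the increments of \<open>y\<close>, so
  \<open>y\<close> is Lipschitz in the time \<open>t\<close>, and \<open>y n - x n\<close> is a tail of a convergent series.
\<close>

definition y :: "nat \<Rightarrow> 'a" where "y n = x n + (\<Sum>k. e (k + n))"

definition field :: "'a \<Rightarrow> 'a" where "field z = (\<Sum>j\<in>I. q j *\<^sub>R h j z)"

lemma t_Suc: "t (Suc n) = t n + a n"
  by (simp add: t_def)

lemma t_less: "m < n \<Longrightarrow> t m < t n"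
  by (rule lift_Suc_mono_less[of t]) (auto simp: t_Suc a_pos)

lemma t_le_iff: "t m \<le> t n \<longleftrightarrow> m \<le> n"
  by (metis t_less le_less_linear linorder_not_le order_le_less)

lemma t_less_iff: "t m < t n \<longleftrightarrow> m < n"
  using t_le_iff[of n m] by auto

lemma t_nonneg: "t n \<ge> 0"
  using t_le_iff[of 0 n] by (simp add: t_def)

lemma t_at_top: "filterlim t at_top sequentially"
  using a_sum by (simp add: t_def[abs_def])

lemma t_diff: "m \<le> n \<Longrightarrow> t n - t m = (\<Sum>k=m..<n. a k)"
  using sum_diff_nat_ivl[of 0 m n a] by (simp add: t_def lessThan_atLeast0)

lemma less_t_Suc_idx: "s < t (Suc (idx s))"
proof -
  have "eventually (\<lambda>n. s + 1 \<le> t n) sequentially"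
    using t_at_top by (simp add: filterlim_at_top)
  then obtain n where "s + 1 \<le> t n" by (auto simp: eventually_sequentially)
  then have "s < t (Suc n)" using t_less[of n "Suc n"] by simp
  then show ?thesis unfolding idx_def by (rule LeastI)
qed

lemma t_idx_le: assumes "s \<ge> 0" shows "t (idx s) \<le> s"
proof (cases "idx s")
  case 0 then show ?thesis using assms by (simp add: t_def)
next
  case (Suc m)
  then have "\<not> s < t (Suc m)" using not_less_Least[of m "\<lambda>n. s < t (Suc n)"] by (simp add: idx_def)
  then show ?thesis using Suc by simp
qed

lemma abs_t_idx: "s \<ge> 0 \<Longrightarrow> \<bar>t (idx s) - s\<bar> \<le> a (idx s)"
  using t_idx_le[of s] less_t_Suc_idx[of s] by (simp add: t_Suc)

lemma idx_mono: "0 \<le> s \<Longrightarrow> s \<le> s' \<Longrightarrow> idx s \<le> idx s'"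
proof -
  assume "0 \<le> s" "s \<le> s'"
  then have "t (idx s) < t (Suc (idx s'))"
    using t_idx_le[of s] less_t_Suc_idx[of s'] by linarith
  then show ?thesis by (simp add: t_less_iff)
qed

lemma index_at_top:
  assumes "filterlim (\<lambda>l. t (n l)) at_top sequentially"
  shows "filterlim n at_top sequentially"
  unfolding filterlim_at_top
proof
  fix Z
  have "eventually (\<lambda>l. t Z \<le> t (n l)) sequentially"
    using assms by (simp add: filterlim_at_top)
  then show "eventually (\<lambda>l. Z \<le> n l) sequentially" by (simp add: t_le_iff)
qed

lemma idx_at_top:
  assumes "filterlim s at_top F"
  shows "filterlim (\<lambda>l. idx (s l)) at_top F"
  unfolding filterlim_at_top
proof
  fix Z
  have "eventually (\<lambda>l. t (Suc Z) \<le> s l) F"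
    using assms by (simp add: filterlim_at_top)
  then show "eventually (\<lambda>l. Z \<le> idx (s l)) F"
  proof eventually_elim
    case (elim l)
    then have "t (Suc Z) < t (Suc (idx (s l)))" using less_t_Suc_idx[of "s l"] by linarith
    then show ?case by (simp add: t_less_iff)
  qed
qed

lemma v_bounded: "\<exists>K>0. \<forall>n. norm (v n) \<le> K"
proof -
  obtain R where R: "\<And>n. norm (x n) \<le> R" using x_bounded by (auto simp: bounded_iff)
  have "\<exists>B. \<forall>n. norm (h j (x n)) \<le> B" if "j \<in> I" for j
  proof -
    have "compact (h j ` cball 0 R)"
      using continuous_on_subset[OF h_cont[OF that]] by (intro compact_continuous_image) auto
    then obtain B where "\<forall>u\<in>h j ` cball 0 R. norm u \<le> B"
      using compact_imp_bounded bounded_iff by blast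
    then show ?thesis using R by (intro exI[of _ B]) (auto simp: dist_norm)
  qed
  then obtain B where B: "\<And>j n. j \<in> I \<Longrightarrow> norm (h j (x n)) \<le> B j" by metis
  have "Bseq r" using r_lim by (intro convergent_imp_Bseq convergentI)
  then obtain b where b: "b > 0" "\<And>n. norm (r n) \<le> b" unfolding Bseq_def by blast
  have "norm (v n) \<le> (\<Sum>j\<in>I. \<bar>B j\<bar>) + b" for n
  proof -
    have "norm (\<Sum>j\<in>I. w n j *\<^sub>R h j (x n)) \<le> (\<Sum>j\<in>I. \<bar>B j\<bar>)"
    proof (rule sum_norm_le)
      fix j assume j: "j \<in> I"
      have "norm (w n j *\<^sub>R h j (x n)) \<le> 1 * \<bar>B j\<bar>"
        unfolding norm_scaleR using w_bound[OF j, of n] B[OF j, of n]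
        by (intro mult_mono) auto
      then show "norm (w n j *\<^sub>R h j (x n)) \<le> \<bar>B j\<bar>" by simp
    qed
    then show ?thesis unfolding v_def using b(2)[of n] norm_triangle_le by (smt (verit))
  qed
  moreover have "(\<Sum>j\<in>I. \<bar>B j\<bar>) + b > 0" using b(1) by (smt (verit) sum_nonneg abs_ge_zero)
  ultimately show ?thesis by blast
qed

lemma y_minus_x: "(\<lambda>n. y n - x n) \<longlonglongrightarrow> 0"
proof -
  have "(\<Sum>k. e (k + n)) = suminf e - (\<Sum>k<n. e k)" for n
    using suminf_minus_initial_segment[OF e_summable, of n] by simp
  moreover have "(\<lambda>n. suminf e - (\<Sum>k<n. e k)) \<longlonglongrightarrow> suminf e - suminf e"
    by (intro tendsto_intros summable_LIMSEQ e_summable)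
  ultimately show ?thesis by (simp add: y_def)
qed

lemma y_Suc: "y (Suc n) = y n + a n *\<^sub>R v n"
proof -
  have "(\<Sum>k. e (Suc k + n)) = (\<Sum>k. e (k + n)) - e (0 + n)"
    using suminf_split_head[of "\<lambda>k. e (k + n)"] e_summable by (simp add: summable_iff_shift[of e n])
  then show ?thesis by (simp add: y_def x_Suc v_def algebra_simps)
qed

lemma y_diff: "m \<le> n \<Longrightarrow> y n - y m = (\<Sum>k=m..<n. a k *\<^sub>R v k)"
  by (induction n rule: dec_induct) (auto simp: y_Suc)

lemma y_lipschitz: "\<exists>K>0. \<forall>m n. norm (y n - y m) \<le> K * \<bar>t n - t m\<bar>"
proof -
  obtain K where K: "K > 0" "\<And>n. norm (v n) \<le> K" using v_bounded by blast
  have *: "norm (y n - y m) \<le> K * \<bar>t n - t m\<bar>" if "m \<le> n" for m n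
  proof -
    have "norm (y n - y m) \<le> (\<Sum>k=m..<n. K * a k)"
      unfolding y_diff[OF that] using K(2) a_pos
      by (intro sum_norm_le) (auto simp: mult.commute less_imp_le intro!: mult_right_mono)
    also have "\<dots> = K * (t n - t m)" by (simp add: t_diff[OF that] sum_distrib_left)
    also have "\<dots> \<le> K * \<bar>t n - t m\<bar>" using K by (intro mult_left_mono) auto
    finally show ?thesis .
  qed
  have "norm (y n - y m) \<le> K * \<bar>t n - t m\<bar>" for m n
    using *[of m n] *[of n m] by (cases m n rule: linorder_le_cases) (simp_all add: norm_minus_commute abs_minus_commute)
  then show ?thesis using K by blast
qed

lemma y_bounded: "bounded (range y)"
proof -
  obtain R where R: "\<And>n. norm (x n) \<le> R" using x_bounded by (auto simp: bounded_iff)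
  have "Bseq (\<lambda>n. y n - x n)" using y_minus_x by (intro convergent_imp_Bseq convergentI)
  then obtain b where b: "\<And>n. norm (y n - x n) \<le> b" unfolding Bseq_def by blast
  have "norm (y n) \<le> R + b" for n
    using R[of n] b[of n] norm_triangle_sub[of "y n" "x n"] by linarith
  then show ?thesis by (auto simp: bounded_iff)
qed

lemma t_idx_shift:
  assumes "filterlim kk at_top sequentially" "s \<ge> 0"
  shows "(\<lambda>l. t (idx (t (kk l) + s)) - t (kk l)) \<longlonglongrightarrow> s"
    and "filterlim (\<lambda>l. idx (t (kk l) + s)) at_top sequentially"
proof -
  have "filterlim (\<lambda>l. t (kk l)) at_top sequentially"
    using filterlim_compose[OF t_at_top assms(1)] .
  then have "filterlim (\<lambda>l. t (kk l) + s) at_top sequentially"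
    by (rule filterlim_at_top_mono) (use assms(2) in auto)
  then show *: "filterlim (\<lambda>l. idx (t (kk l) + s)) at_top sequentially"
    by (rule idx_at_top)
  have "(\<lambda>l. a (idx (t (kk l) + s))) \<longlonglongrightarrow> 0"
    using filterlim_compose[OF a_lim *] .
  then have "(\<lambda>l. t (idx (t (kk l) + s)) - t (kk l) - s) \<longlonglongrightarrow> 0"
  proof (rule Lim_null_comparison[rotated], intro always_eventually allI)
    fix l
    show "norm (t (idx (t (kk l) + s)) - t (kk l) - s) \<le> a (idx (t (kk l) + s))"
      using abs_t_idx[of "t (kk l) + s"] assms(2) t_nonneg[of "kk l"] by (simp add: algebra_simps)
  qed
  then show "(\<lambda>l. t (idx (t (kk l) + s)) - t (kk l)) \<longlonglongrightarrow> s"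
    by (simp add: LIM_zero_iff)
qed

text \<open>
  Since \<open>y\<close> is Lipschitz in time, index sequences with asymptotically equal times see the same limit.
  This takes the place of continuity of an interpolated path.
\<close>

lemma y_near:
  assumes "(\<lambda>l. t (n l) - t (m l)) \<longlonglongrightarrow> 0"
  shows "(\<lambda>l. y (n l) - y (m l)) \<longlonglongrightarrow> 0"
proof -
  obtain K where K: "K > 0" "\<And>m n. norm (y n - y m) \<le> K * \<bar>t n - t m\<bar>" using y_lipschitz by blast
  have "(\<lambda>l. K * \<bar>t (n l) - t (m l)\<bar>) \<longlonglongrightarrow> K * \<bar>0\<bar>"
    by (intro tendsto_mult_left tendsto_rabs assms)
  then have "(\<lambda>l. K * \<bar>t (n l) - t (m l)\<bar>) \<longlonglongrightarrow> 0" by simp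
  moreover have "eventually (\<lambda>l. norm (y (n l) - y (m l)) \<le> K * \<bar>t (n l) - t (m l)\<bar>) sequentially"
    using K(2) by (intro always_eventually) auto
  ultimately show ?thesis by (rule Lim_null_comparison[rotated])
qed

text \<open>
  \<open>Z\<close> is the limit of the piecewise constant path of \<open>y\<close> restarted at the steps \<open>kk l\<close>. Since the
  gains tend to zero, its jumps disappear in the limit.
\<close>

definition shift_limit :: "(nat \<Rightarrow> nat) \<Rightarrow> (real \<Rightarrow> 'a) \<Rightarrow> bool" where
  "shift_limit kk Z \<longleftrightarrow> filterlim kk at_top sequentially \<and>
     (\<forall>s\<ge>0. (\<lambda>l. y (idx (t (kk l) + s))) \<longlonglongrightarrow> Z s)"

text \<open>
  The Arzela-Ascoli argument on \<open>[0, \<infinity>)\<close>: a diagonal subsequence converges at all rational times, and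
  the asymptotic Lipschitz bound carries convergence over to all other times.
\<close>

lemma shift_limit_exists:
  assumes "filterlim kk at_top sequentially"
  obtains \<phi> Z where "strict_mono (\<phi> :: nat \<Rightarrow> nat)" "shift_limit (kk \<circ> \<phi>) Z"
proof -
  obtain B where B: "\<And>n. norm (y n) \<le> B" using y_bounded by (auto simp: bounded_iff)
  define Y where "Y l s = y (idx (t (kk l) + s))" for l s
  obtain \<phi> where \<phi>: "strict_mono (\<phi> :: nat \<Rightarrow> nat)"
    and lim: "\<And>s. s \<in> \<rat> \<Longrightarrow> \<exists>l. (\<lambda>n. Y (\<phi> n) s) \<longlonglongrightarrow> l"
    by (rule function_convergent_subsequence[of "\<rat> :: real set" Y B])
       (auto simp: Y_def B countable_rat)
  define K' where "K' = kk \<circ> \<phi>"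
  have kf: "filterlim K' at_top sequentially"
    unfolding K'_def comp_def by (rule filterlim_compose[OF assms filterlim_subseq[OF \<phi>]])
  obtain K where K: "K > 0" "\<And>m n. norm (y n - y m) \<le> K * \<bar>t n - t m\<bar>" using y_lipschitz by blast
  have "convergent (\<lambda>l. Y (\<phi> l) s)" if s: "s \<ge> 0" for s
  proof -
    have "Cauchy (\<lambda>l. Y (\<phi> l) s)"
    proof (rule metric_CauchyI)
      fix \<epsilon> :: real assume \<epsilon>: "\<epsilon> > 0"
      obtain u where u: "u \<in> \<rat>" "s < u" "u < s + \<epsilon> / (3 * K)"
        using Rats_dense_in_real[of s "s + \<epsilon> / (3 * K)"] \<epsilon> K by auto
      have "u \<ge> 0" using u s by simp
      have "(\<lambda>l. K * \<bar>(t (idx (t (K' l) + s)) - t (K' l)) - (t (idx (t (K' l) + u)) - t (K' l))\<bar>)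
              \<longlonglongrightarrow> K * \<bar>s - u\<bar>"
        by (intro tendsto_mult_left tendsto_rabs tendsto_diff[OF t_idx_shift(1)[OF kf s] t_idx_shift(1)[OF kf \<open>u \<ge> 0\<close>]])
      moreover have "K * \<bar>s - u\<bar> < \<epsilon> / 3"
        using u K by (simp add: field_simps)
      ultimately have "eventually (\<lambda>l. K * \<bar>(t (idx (t (K' l) + s)) - t (K' l)) -
          (t (idx (t (K' l) + u)) - t (K' l))\<bar> < \<epsilon> / 3) sequentially"
        by (rule order_tendstoD)
      then have ev: "eventually (\<lambda>l. dist (Y (\<phi> l) s) (Y (\<phi> l) u) < \<epsilon> / 3) sequentially"
      proof eventually_elim
        case (elim l)
        show ?case
          using elim K(2)[of "idx (t (K' l) + s)" "idx (t (K' l) + u)"]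
          by (simp add: Y_def dist_norm K'_def)
      qed
      then obtain N1 where N1: "\<And>l. l \<ge> N1 \<Longrightarrow> dist (Y (\<phi> l) s) (Y (\<phi> l) u) < \<epsilon> / 3"
        by (auto simp: eventually_sequentially)
      obtain N2 where N2: "\<And>l m. l \<ge> N2 \<Longrightarrow> m \<ge> N2 \<Longrightarrow> dist (Y (\<phi> l) u) (Y (\<phi> m) u) < \<epsilon> / 3"
      proof -
        have "Cauchy (\<lambda>n. Y (\<phi> n) u)" using lim[OF u(1)] LIMSEQ_imp_Cauchy by blast
        from metric_CauchyD[OF this, of "\<epsilon> / 3"] \<epsilon> that show thesis by auto
      qed
      show "\<exists>N. \<forall>l\<ge>N. \<forall>m\<ge>N. dist (Y (\<phi> l) s) (Y (\<phi> m) s) < \<epsilon>"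
      proof (intro exI[of _ "max N1 N2"] allI impI)
        fix l m assume "max N1 N2 \<le> l" "max N1 N2 \<le> m"
        then have "dist (Y (\<phi> l) s) (Y (\<phi> l) u) < \<epsilon> / 3" "dist (Y (\<phi> m) s) (Y (\<phi> m) u) < \<epsilon> / 3"
          "dist (Y (\<phi> l) u) (Y (\<phi> m) u) < \<epsilon> / 3"
          using N1 N2 by auto
        then show "dist (Y (\<phi> l) s) (Y (\<phi> m) s) < \<epsilon>"
          using dist_triangle[of "Y (\<phi> l) s" "Y (\<phi> m) s" "Y (\<phi> l) u"]
            dist_triangle2[of "Y (\<phi> l) u" "Y (\<phi> m) s" "Y (\<phi> m) u"] by linarith
      qed
    qed
    then show ?thesis by (rule Cauchy_convergent)
  qed
  then have "\<forall>s\<ge>0. (\<lambda>l. y (idx (t (K' l) + s))) \<longlonglongrightarrow> lim (\<lambda>l. Y (\<phi> l) s)"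
    by (simp add: convergent_LIMSEQ_iff Y_def K'_def)
  then have "shift_limit (kk \<circ> \<phi>) (\<lambda>s. lim (\<lambda>l. Y (\<phi> l) s))"
    using kf by (simp add: shift_limit_def K'_def)
  with \<phi> show thesis by (rule that)
qed

lemma shift_limit_subseq:
  "shift_limit kk Z \<Longrightarrow> strict_mono (\<psi> :: nat \<Rightarrow> nat) \<Longrightarrow> shift_limit (kk \<circ> \<psi>) Z"
  unfolding shift_limit_def comp_def
  by (intro conjI allI impI; elim conjE)
    (auto intro: filterlim_compose[OF _ filterlim_subseq[of \<psi>]])

text \<open>
  The form in which convergence is used below: evaluation points may vary with \<open>l\<close> as long as the elapsed
  times converge, and then the original iterates \<open>x\<close> converge as well.
\<close>

lemma shift_limit_tendsto:
  assumes Z: "shift_limit kk Z" and T: "T \<ge> 0" and n: "(\<lambda>l. t (n l) - t (kk l)) \<longlonglongrightarrow> T"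
  shows "(\<lambda>l. y (n l)) \<longlonglongrightarrow> Z T" and "(\<lambda>l. x (n l)) \<longlonglongrightarrow> Z T"
proof -
  have kk: "filterlim kk at_top sequentially" using Z by (simp add: shift_limit_def)
  have "(\<lambda>l. (t (n l) - t (kk l)) - (t (idx (t (kk l) + T)) - t (kk l))) \<longlonglongrightarrow> T - T"
    by (rule tendsto_diff[OF n t_idx_shift(1)[OF kk T]])
  then have "(\<lambda>l. y (n l) - y (idx (t (kk l) + T))) \<longlonglongrightarrow> 0"
    by (intro y_near) simp
  moreover have "(\<lambda>l. y (idx (t (kk l) + T))) \<longlonglongrightarrow> Z T"
    using Z T by (simp add: shift_limit_def)
  ultimately have "(\<lambda>l. (y (n l) - y (idx (t (kk l) + T))) + y (idx (t (kk l) + T))) \<longlonglongrightarrow> 0 + Z T"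
    by (rule tendsto_add)
  then show y: "(\<lambda>l. y (n l)) \<longlonglongrightarrow> Z T" by simp
  have "filterlim (\<lambda>l. t (n l)) at_top sequentially"
    using filterlim_tendsto_add_at_top[OF n filterlim_compose[OF t_at_top kk]] by simp
  then have "filterlim n at_top sequentially" by (rule index_at_top)
  from filterlim_compose[OF y_minus_x this] have "(\<lambda>l. y (n l) - x (n l)) \<longlonglongrightarrow> 0" .
  then have "(\<lambda>l. y (n l) - (y (n l) - x (n l))) \<longlonglongrightarrow> Z T - 0" by (rule tendsto_diff[OF y])
  moreover have "(\<lambda>l. y (n l) - (y (n l) - x (n l))) = (\<lambda>l. x (n l))" by (rule ext) (simp only: diff_diff_eq2 add_diff_cancel_left')
  ultimately show "(\<lambda>l. x (n l)) \<longlonglongrightarrow> Z T" by (simp only: diff_zero)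
qed

text \<open>
  Why restarted limits follow the mean field. In a short window around time \<open>t0\<close> the iterates stay near
  \<open>Z t0\<close>, so each \<open>h j (x k)\<close> may be replaced by the constant vector \<open>h j (Z t0)\<close>. What remains is the sum
  over the window of \<open>a k * w k j\<close>, which differs from \<open>q j\<close> times the elapsed time by a Cauchy
  difference of the convergent series in \<open>w_average\<close>.
\<close>

lemma shift_limit_increment:
  assumes Z: "shift_limit kk Z" and t0: "t0 \<ge> 0" and \<epsilon>: "\<epsilon> > 0"
  obtains \<delta> where "\<delta> > 0"
    "\<And>s s'. 0 \<le> s \<Longrightarrow> s \<le> s' \<Longrightarrow> \<bar>s - t0\<bar> \<le> \<delta> \<Longrightarrow> \<bar>s' - t0\<bar> \<le> \<delta> \<Longrightarrow>
       norm (Z s' - Z s - (s' - s) *\<^sub>R field (Z t0)) \<le> \<epsilon> * (s' - s)"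
proof -
  have kk: "filterlim kk at_top sequentially" using Z by (simp add: shift_limit_def)
  obtain K where K: "K > 0" "\<And>m n. norm (y n - y m) \<le> K * \<bar>t n - t m\<bar>" using y_lipschitz by blast
  \<comment> \<open>half of \<open>\<epsilon>\<close> is spent on freezing the fields \<open>h j\<close>, the other half on the errors \<open>r k\<close>\<close>
  define \<epsilon>' where "\<epsilon>' = \<epsilon> / (2 * (card I + 1))"
  have \<epsilon>': "\<epsilon>' > 0" using \<epsilon> by (simp add: \<epsilon>'_def)
  have "\<exists>\<omega>>0. \<forall>u. norm (u - Z t0) < \<omega> \<longrightarrow> norm (h j u - h j (Z t0)) \<le> \<epsilon>'" if "j \<in> I" for j
  proof -
    have "isCont (h j) (Z t0)" using h_cont[OF that] by (simp add: continuous_on_eq_continuous_at)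
    then obtain \<omega> where \<omega>: "\<omega> > 0" "\<forall>u. dist u (Z t0) < \<omega> \<longrightarrow> dist (h j u) (h j (Z t0)) < \<epsilon>'"
      unfolding continuous_at_eps_delta using \<epsilon>' by blast
    show ?thesis
    proof (intro exI[of _ \<omega>] conjI allI impI)
      fix u assume "norm (u - Z t0) < \<omega>"
      then show "norm (h j u - h j (Z t0)) \<le> \<epsilon>'" using \<omega>(2)[rule_format, of u] by (simp add: dist_norm)
    qed (fact \<omega>(1))
  qed
  then obtain \<omega>f where \<omega>f: "\<And>j. j \<in> I \<Longrightarrow> \<omega>f j > 0"
    "\<And>j u. j \<in> I \<Longrightarrow> norm (u - Z t0) < \<omega>f j \<Longrightarrow> norm (h j u - h j (Z t0)) \<le> \<epsilon>'" by metis
  define \<omega> where "\<omega> = Min (insert 1 (\<omega>f ` I))"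
  have \<omega>: "\<omega> > 0" using finite_I \<omega>f(1) by (auto simp: \<omega>_def)
  have \<omega>2: "norm (h j u - h j (Z t0)) \<le> \<epsilon>'" if "j \<in> I" "norm (u - Z t0) < \<omega>" for j u
  proof -
    have "\<omega> \<le> \<omega>f j" using finite_I that unfolding \<omega>_def by (intro Min_le) auto
    then show ?thesis using \<omega>f(2)[OF that(1)] that(2) by auto
  qed
  \<comment> \<open>all steps of the window are eventually within time \<open>2 * \<delta>\<close> of \<open>t0\<close>, and \<open>y\<close> has speed at most \<open>K\<close>:
    it moves by at most \<open>\<omega> / 4\<close>, which leaves room for \<open>y k - x k\<close> and for \<open>y (p l) - Z t0\<close>\<close>
  define \<delta> where "\<delta> = \<omega> / (8 * K)"
  have \<delta>: "\<delta> > 0" "K * \<delta> = \<omega> / 8" using K \<omega> by (auto simp: \<delta>_def)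
  have "norm (Z s' - Z s - (s' - s) *\<^sub>R field (Z t0)) \<le> \<epsilon> * (s' - s)"
    if s: "0 \<le> s" "s \<le> s'" "\<bar>s - t0\<bar> \<le> \<delta>" "\<bar>s' - t0\<bar> \<le> \<delta>" for s s'
  proof -
    have s': "s' \<ge> 0" using s by simp
    define m n p where "m l = idx (t (kk l) + s)" and "n l = idx (t (kk l) + s')"
      and "p l = idx (t (kk l) + t0)" for l
    have mn: "m l \<le> n l" for l using s t_nonneg[of "kk l"] unfolding m_def n_def by (intro idx_mono) auto
    have tm: "(\<lambda>l. t (m l) - t (kk l)) \<longlonglongrightarrow> s" and m: "filterlim m at_top sequentially"
      using t_idx_shift[OF kk s(1)] by (simp_all add: m_def[abs_def])
    have tn: "(\<lambda>l. t (n l) - t (kk l)) \<longlonglongrightarrow> s'"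
      using t_idx_shift[OF kk s'] by (simp_all add: n_def[abs_def])
    have tp: "(\<lambda>l. t (p l) - t (kk l)) \<longlonglongrightarrow> t0" and p: "filterlim p at_top sequentially"
      using t_idx_shift[OF kk t0] by (simp_all add: p_def[abs_def])
    have tnm: "(\<lambda>l. t (n l) - t (m l)) \<longlonglongrightarrow> s' - s"
      using tendsto_diff[OF tn tm] by simp
    have ym: "(\<lambda>l. y (m l)) \<longlonglongrightarrow> Z s" and yn: "(\<lambda>l. y (n l)) \<longlonglongrightarrow> Z s'" and yp: "(\<lambda>l. y (p l)) \<longlonglongrightarrow> Z t0"
      using Z s s' t0 by (simp_all add: shift_limit_def m_def n_def p_def)
    have ev1: "eventually (\<lambda>l. \<bar>t (m l) - t (p l)\<bar> < 2 * \<delta>) sequentially"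
    proof (rule order_tendstoD)
      show "(\<lambda>l. \<bar>t (m l) - t (p l)\<bar>) \<longlonglongrightarrow> \<bar>s - t0\<bar>"
        using tendsto_rabs[OF tendsto_diff[OF tm tp]] by simp
    qed (use s \<delta> in auto)
    have ev2: "eventually (\<lambda>l. \<bar>t (n l) - t (p l)\<bar> < 2 * \<delta>) sequentially"
    proof (rule order_tendstoD)
      show "(\<lambda>l. \<bar>t (n l) - t (p l)\<bar>) \<longlonglongrightarrow> \<bar>s' - t0\<bar>"
        using tendsto_rabs[OF tendsto_diff[OF tn tp]] by simp
    qed (use s \<delta> in auto)
    have ev3: "eventually (\<lambda>l. norm (y (p l) - Z t0) < \<omega> / 4) sequentially"
      using tendstoD[OF yp, of "\<omega> / 4"] \<omega> by (simp add: dist_norm)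
    have small: "eventually (\<lambda>l. \<forall>k\<ge>m l. P k) sequentially" if ev: "eventually P sequentially" for P
    proof -
      obtain N where "\<And>k. k \<ge> N \<Longrightarrow> P k" using ev by (auto simp: eventually_sequentially)
      moreover have "eventually (\<lambda>l. N \<le> m l) sequentially" using m by (simp add: filterlim_at_top)
      ultimately show ?thesis by (auto elim!: eventually_mono)
    qed
    have ev4: "eventually (\<lambda>l. \<forall>k\<ge>m l. norm (y k - x k) < \<omega> / 4) sequentially"
      using tendstoD[OF y_minus_x, of "\<omega> / 4"] \<omega> by (intro small) simp
    have ev5: "eventually (\<lambda>l. \<forall>k\<ge>m l. norm (r k) < \<epsilon> / 2) sequentially"
      using tendstoD[OF r_lim, of "\<epsilon> / 2"] \<epsilon> by (intro small) simp
    define D where "D j l = (\<Sum>k=m l..<n l. a k * (w k j - q j))" for j l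
    have D: "(\<lambda>l. D j l) \<longlonglongrightarrow> 0" if "j \<in> I" for j
    proof -
      have eq: "D j l = (\<Sum>k<n l. a k * (w k j - q j)) - (\<Sum>k<m l. a k * (w k j - q j))" for l
        using sum_diff_nat_ivl[of 0 "m l" "n l" "\<lambda>k. a k * (w k j - q j)"] mn[of l]
        by (simp add: D_def lessThan_atLeast0)
      have n: "filterlim n at_top sequentially"
        using t_idx_shift[OF kk s'] by (simp_all add: n_def[abs_def])
      note L = summable_LIMSEQ[OF w_average[OF that]]
      show ?thesis unfolding eq
        using tendsto_diff[OF filterlim_compose[OF L n] filterlim_compose[OF L m]] by simp
    qed
    have bound: "eventually (\<lambda>l. norm (y (n l) - y (m l) - (t (n l) - t (m l)) *\<^sub>R field (Z t0))
         \<le> \<epsilon> * (t (n l) - t (m l)) + (\<Sum>j\<in>I. \<bar>D j l\<bar> * norm (h j (Z t0)))) sequentially"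
      using ev1 ev2 ev3 ev4 ev5
    proof eventually_elim
      case (elim l)
      have near: "norm (x k - Z t0) < \<omega>" if k: "k \<in> {m l..<n l}" for k
      proof -
        have "t (m l) \<le> t k" "t k \<le> t (n l)" using k by (simp_all add: t_le_iff)
        then have "\<bar>t k - t (p l)\<bar> \<le> 2 * \<delta>" using elim(1,2) by linarith
        then have "norm (y k - y (p l)) \<le> K * (2 * \<delta>)"
          by (intro order_trans[OF K(2)] mult_left_mono) (use K(1) in auto)
        then have "norm (y k - y (p l)) \<le> \<omega> / 4" using \<delta> by simp
        moreover have "norm (y k - x k) < \<omega> / 4" using elim(4) k by auto
        moreover have "norm (y (p l) - Z t0) < \<omega> / 4" by fact
        moreover have "x k - Z t0 = (y k - y (p l)) - (y k - x k) + (y (p l) - Z t0)" by simp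
        ultimately show ?thesis
          using norm_triangle_ineq[of "(y k - y (p l)) - (y k - x k)" "y (p l) - Z t0"]
            norm_triangle_ineq4[of "y k - y (p l)" "y k - x k"] \<omega> by simp
      qed
      have "y (n l) - y (m l) - (t (n l) - t (m l)) *\<^sub>R field (Z t0) =
          (\<Sum>k=m l..<n l. a k *\<^sub>R ((\<Sum>j\<in>I. w k j *\<^sub>R (h j (x k) - h j (Z t0))) + r k)) +
          (\<Sum>j\<in>I. D j l *\<^sub>R h j (Z t0))"
      proof -
        have "(\<Sum>j\<in>I. D j l *\<^sub>R h j (Z t0)) =
            (\<Sum>k=m l..<n l. \<Sum>j\<in>I. (a k * (w k j - q j)) *\<^sub>R h j (Z t0))"
          by (subst sum.swap) (simp add: D_def scaleR_sum_left)
        moreover have "a k *\<^sub>R ((\<Sum>j\<in>I. w k j *\<^sub>R (h j (x k) - h j (Z t0))) + r k) +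
            (\<Sum>j\<in>I. (a k * (w k j - q j)) *\<^sub>R h j (Z t0)) = a k *\<^sub>R v k - a k *\<^sub>R field (Z t0)" for k
          unfolding v_def field_def scaleR_add_right scaleR_sum_right
          by (simp add: sum.distrib[symmetric] sum_subtractf[symmetric] algebra_simps)
        ultimately have "(\<Sum>k=m l..<n l. a k *\<^sub>R ((\<Sum>j\<in>I. w k j *\<^sub>R (h j (x k) - h j (Z t0))) + r k)) +
          (\<Sum>j\<in>I. D j l *\<^sub>R h j (Z t0)) = (\<Sum>k=m l..<n l. a k *\<^sub>R v k - a k *\<^sub>R field (Z t0))"
          by (simp add: sum.distrib[symmetric])
        then show ?thesis
          by (simp add: y_diff[OF mn] t_diff[OF mn] sum_subtractf scaleR_sum_left)
      qed
      also have "norm \<dots> \<le> (\<Sum>k=m l..<n l. a k * \<epsilon>) + (\<Sum>j\<in>I. \<bar>D j l\<bar> * norm (h j (Z t0)))"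
      proof (intro norm_triangle_mono sum_norm_le)
        fix k assume k: "k \<in> {m l..<n l}"
        have "norm (\<Sum>j\<in>I. w k j *\<^sub>R (h j (x k) - h j (Z t0))) \<le> (\<Sum>j\<in>I. \<epsilon>')"
        proof (rule sum_norm_le)
          fix j assume j: "j \<in> I"
          have "norm (w k j *\<^sub>R (h j (x k) - h j (Z t0))) \<le> 1 * \<epsilon>'"
            unfolding norm_scaleR using w_bound[OF j, of k] \<omega>2[OF j near[OF k]]
            by (intro mult_mono) auto
          then show "norm (w k j *\<^sub>R (h j (x k) - h j (Z t0))) \<le> \<epsilon>'" by simp
        qed
        also have "\<dots> \<le> \<epsilon> / 2" using \<epsilon> by (simp add: \<epsilon>'_def field_simps)
        finally have "norm ((\<Sum>j\<in>I. w k j *\<^sub>R (h j (x k) - h j (Z t0))) + r k) \<le> \<epsilon>"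
          using elim(5) k norm_triangle_ineq[of "\<Sum>j\<in>I. w k j *\<^sub>R (h j (x k) - h j (Z t0))" "r k"]
          by force
        then show "norm (a k *\<^sub>R ((\<Sum>j\<in>I. w k j *\<^sub>R (h j (x k) - h j (Z t0))) + r k)) \<le> a k * \<epsilon>"
          using a_pos[of k] by simp
      qed simp
      also have "(\<Sum>k=m l..<n l. a k * \<epsilon>) = \<epsilon> * (t (n l) - t (m l))"
        by (simp add: t_diff[OF mn] sum_distrib_left mult.commute)
      finally show ?case .
    qed
    have lhs: "(\<lambda>l. norm (y (n l) - y (m l) - (t (n l) - t (m l)) *\<^sub>R field (Z t0)))
        \<longlonglongrightarrow> norm (Z s' - Z s - (s' - s) *\<^sub>R field (Z t0))"
      by (intro tendsto_norm tendsto_diff[OF tendsto_diff[OF yn ym] tendsto_scaleR[OF tnm tendsto_const]])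
    have rhs: "(\<lambda>l. \<epsilon> * (t (n l) - t (m l)) + (\<Sum>j\<in>I. \<bar>D j l\<bar> * norm (h j (Z t0))))
        \<longlonglongrightarrow> \<epsilon> * (s' - s) + (\<Sum>j\<in>I. \<bar>0\<bar> * norm (h j (Z t0)))"
      by (intro tendsto_add tendsto_mult_left[OF tnm] tendsto_sum tendsto_mult_right tendsto_rabs D)
    from tendsto_le[OF sequentially_bot rhs lhs bound] show ?thesis by simp
  qed
  with \<delta>(1) show thesis by (rule that)
qed

lemma shift_limit_solution:
  assumes Z: "shift_limit kk Z"
  shows "ode_solution field \<infinity> Z"
  unfolding ode_solution_def
proof (intro conjI allI impI)
  fix t0 :: real assume t0: "t0 \<ge> 0"
  show "(Z has_vector_derivative field (Z t0)) (at t0 within {0..})"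
    unfolding has_vector_derivative_def has_derivative_within_alt
  proof (intro conjI allI impI bounded_linear_scaleR_left)
    fix \<epsilon> :: real assume "\<epsilon> > 0"
    then obtain \<delta> where \<delta>: "\<delta> > 0"
      "\<And>s s'. 0 \<le> s \<Longrightarrow> s \<le> s' \<Longrightarrow> \<bar>s - t0\<bar> \<le> \<delta> \<Longrightarrow> \<bar>s' - t0\<bar> \<le> \<delta> \<Longrightarrow>
       norm (Z s' - Z s - (s' - s) *\<^sub>R field (Z t0)) \<le> \<epsilon> * (s' - s)"
      using shift_limit_increment[OF Z t0] by blast
    show "\<exists>d>0. \<forall>s\<in>{0..}. norm (s - t0) < d \<longrightarrow>
        norm (Z s - Z t0 - (s - t0) *\<^sub>R field (Z t0)) \<le> \<epsilon> * norm (s - t0)"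
    proof (intro exI[of _ \<delta>] conjI ballI impI \<delta>(1))
      fix s :: real assume s: "s \<in> {0..}" "norm (s - t0) < \<delta>"
      show "norm (Z s - Z t0 - (s - t0) *\<^sub>R field (Z t0)) \<le> \<epsilon> * norm (s - t0)"
      proof (cases "s \<le> t0")
        case False
        then show ?thesis using \<delta>(2)[of t0 s] \<delta>(1) s t0 by simp
      next
        case True
        have "Z s - Z t0 - (s - t0) *\<^sub>R field (Z t0) = - (Z t0 - Z s - (t0 - s) *\<^sub>R field (Z t0))"
          by (simp add: algebra_simps)
        then have "norm (Z s - Z t0 - (s - t0) *\<^sub>R field (Z t0)) = norm (Z t0 - Z s - (t0 - s) *\<^sub>R field (Z t0))"
          by (simp only: norm_minus_cancel)
        then show ?thesis using \<delta>(2)[of s t0] \<delta>(1) s t0 True by simp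
      qed
    qed
  qed
qed simp

lemma shift_limit_start:
  assumes "shift_limit kk Z" shows "(\<lambda>l. x (kk l)) \<longlonglongrightarrow> Z 0"
  using shift_limit_tendsto(2)[OF assms, of 0 kk] by simp

lemma shift_limit_idx:
  assumes Z: "shift_limit kk Z" and T: "T \<ge> 0"
  shows "(\<lambda>l. x (idx (t (kk l) + T))) \<longlonglongrightarrow> Z T"
proof (rule shift_limit_tendsto(2)[OF Z T])
  show "(\<lambda>l. t (idx (t (kk l) + T)) - t (kk l)) \<longlonglongrightarrow> T"
    using Z T by (intro t_idx_shift(1)) (simp_all add: shift_limit_def)
qed

text \<open>
  Restart at the visits to \<open>A\<close>. By compactness the limit path starts in \<open>A\<close>, hence is attracted to \<open>z\<close>,
  and the iterates follow it into any neighbourhood of \<open>z\<close>.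
\<close>

lemma frequently_near_equilibrium:
  assumes A: "compact A" "A \<subseteq> domain_of_attraction field z" and io: "\<exists>\<^sub>\<infinity>k. x k \<in> A"
    and \<delta>: "\<delta> > 0"
  shows "\<exists>\<^sub>\<infinity>k. dist (x k) z < \<delta>"
proof -
  define kk where "kk = enumerate {k. x k \<in> A}"
  have inf: "infinite {k. x k \<in> A}" using io by (simp add: frequently_cofinite)
  have kA: "x (kk l) \<in> A" for l using enumerate_in_set[OF inf, of l] by (simp add: kk_def)
  have "filterlim kk at_top sequentially"
    unfolding kk_def using inf by (intro filterlim_subseq strict_mono_enumerate)
  then obtain \<phi> Z where \<phi>: "strict_mono (\<phi> :: nat \<Rightarrow> nat)" and Z: "shift_limit (kk \<circ> \<phi>) Z"
    by (rule shift_limit_exists)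
  have "Z 0 \<in> A"
    using compact_imp_closed[OF A(1)] shift_limit_start[OF Z] kA
    by (intro Lim_in_closed_set[of A "\<lambda>l. x ((kk \<circ> \<phi>) l)" sequentially]) auto
  then have "(Z \<longlongrightarrow> z) at_top"
    using solution_tendsto[OF shift_limit_solution[OF Z]] A(2) by auto
  then have "eventually (\<lambda>T. dist (Z T) z < \<delta>) at_top" using \<delta> by (rule tendstoD)
  then have "eventually (\<lambda>T. dist (Z T) z < \<delta> \<and> T \<ge> 0) at_top"
    using eventually_ge_at_top[of "0::real"] by eventually_elim auto
  then obtain T where T: "T \<ge> 0" "dist (Z T) z < \<delta>"
    using eventually_happens'[OF trivial_limit_at_top_linorder] by blast
  define n where "n l = idx (t ((kk \<circ> \<phi>) l) + T)" for l
  have "(\<lambda>l. dist (x (n l)) z) \<longlonglongrightarrow> dist (Z T) z"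
    unfolding n_def by (intro tendsto_intros shift_limit_idx Z T)
  then have "eventually (\<lambda>l. dist (x (n l)) z < \<delta>) sequentially" using T(2) by (rule order_tendstoD)
  moreover have "filterlim n at_top sequentially"
    unfolding n_def using Z T(1) by (intro t_idx_shift(2)) (simp_all only: shift_limit_def)
  ultimately have "frequently (\<lambda>k. dist (x k) z < \<delta>) sequentially"
    unfolding frequently_def filterlim_iff
    by (metis (mono_tags, lifting) eventually_happens' eventually_conj sequentially_bot)
  then show ?thesis by (simp add: cofinite_eq_sequentially)
qed

text \<open>
  If \<open>x\<close> did not converge, it would leave an \<open>\<epsilon>\<close>-ball again and again after entering a \<open>\<delta>\<close>-ball. Restart at
  the last step \<open>mm l\<close> in the \<open>\<delta>\<close>-ball before such an exit \<open>nn l\<close>. The limit path starts within \<open>\<delta>\<close> of \<open>z\<close>,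
  so it stays within \<open>\<epsilon>\<close> forever and returns to the \<open>\<delta>\<close>-ball at some time \<open>T\<close>. As the iterates keep
  out of the \<open>\<delta>\<close>-ball until the exit, the exit comes within time \<open>T\<close>, hence is visible on the limit
  path, a contradiction.
\<close>

theorem converges:
  assumes st: "locally_asymptotically_stable field z"
    and A: "compact A" "A \<subseteq> domain_of_attraction field z" and io: "\<exists>\<^sub>\<infinity>k. x k \<in> A"
  shows "x \<longlonglongrightarrow> z"
proof (rule ccontr)
  assume "\<not> x \<longlonglongrightarrow> z"
  then obtain \<epsilon> where \<epsilon>: "\<epsilon> > 0" "\<not> eventually (\<lambda>k. dist (x k) z < \<epsilon>) sequentially"
    unfolding tendsto_iff by blast
  from st obtain \<eta> where \<eta>: "\<eta> > 0" "ball z \<eta> \<subseteq> domain_of_attraction field z"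
    by (auto simp: locally_asymptotically_stable_def)
  from st have "lyapunov_stable field z" by (simp add: locally_asymptotically_stable_def)
  then obtain \<delta>0 where "\<delta>0 > 0" and stab: "\<forall>T Z. ode_solution field T Z \<and> dist (Z 0) z < \<delta>0 \<longrightarrow>
        (\<forall>t\<ge>0. ereal t < T \<longrightarrow> dist (Z t) z < \<epsilon>)"
    using \<epsilon>(1) unfolding lyapunov_stable_def by blast
  then have \<delta>0: "\<delta>0 > 0" "\<And>Z t. ode_solution field \<infinity> Z \<Longrightarrow> dist (Z 0) z < \<delta>0 \<Longrightarrow> t \<ge> 0 \<Longrightarrow> dist (Z t) z < \<epsilon>"
    using stab[rule_format, of \<infinity>] by auto
  define \<delta> where "\<delta> = min (min \<delta>0 \<eta>) \<epsilon> / 2"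
  have \<delta>: "\<delta> > 0" "\<delta> < \<delta>0" "\<delta> < \<eta>" "\<delta> < \<epsilon>" using \<delta>0(1) \<eta>(1) \<epsilon>(1) by (auto simp: \<delta>_def)
  have "\<exists>m n. l \<le> m \<and> m < n \<and> dist (x m) z < \<delta> \<and> dist (x n) z \<ge> \<epsilon> \<and> (\<forall>k. m < k \<and> k \<le> n \<longrightarrow> dist (x k) z \<ge> \<delta>)" for l
  proof -
    obtain m0 where m0: "m0 \<ge> l" "dist (x m0) z < \<delta>"
      using frequently_near_equilibrium[OF A io \<delta>(1)] unfolding INFM_nat_le by blast
    obtain n where n: "n \<ge> m0" "dist (x n) z \<ge> \<epsilon>"
      using \<epsilon>(2) unfolding eventually_sequentially by (meson not_less)
    define m where "m = (GREATEST k. k \<le> n \<and> dist (x k) z < \<delta>)"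
    have m: "m \<le> n \<and> dist (x m) z < \<delta>"
      unfolding m_def by (rule GreatestI_nat[of _ m0 n]) (use m0 n in auto)
    have mm: "k \<le> m" if "k \<le> n" "dist (x k) z < \<delta>" for k
      unfolding m_def by (rule Greatest_le_nat[of _ k n]) (use that in auto)
    show ?thesis
    proof (intro exI conjI allI impI)
      show "l \<le> m" using mm[OF n(1) m0(2)] m0 by simp
      show "m < n" using m n(2) \<delta>(4) by (cases "m = n") auto
      show "dist (x m) z < \<delta>" "dist (x n) z \<ge> \<epsilon>" using m n by auto
      fix k assume "m < k \<and> k \<le> n"
      then show "dist (x k) z \<ge> \<delta>" using mm[of k] by (meson not_less)
    qed
  qed
  then obtain mm nn where mm: "\<And>l. l \<le> mm l" "\<And>l. mm l < nn l" "\<And>l. dist (x (mm l)) z < \<delta>"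
     "\<And>l. dist (x (nn l)) z \<ge> \<epsilon>" "\<And>l k. mm l < k \<Longrightarrow> k \<le> nn l \<Longrightarrow> dist (x k) z \<ge> \<delta>"
    by metis
  have "filterlim mm at_top sequentially"
    by (rule filterlim_at_top_mono[OF filterlim_ident]) (use mm(1) in auto)
  then obtain \<phi> Z where \<phi>: "strict_mono (\<phi> :: nat \<Rightarrow> nat)" and Z: "shift_limit (mm \<circ> \<phi>) Z"
    by (rule shift_limit_exists)
  have sol: "ode_solution field \<infinity> Z" by (rule shift_limit_solution[OF Z])
  have "(\<lambda>l. dist (x ((mm \<circ> \<phi>) l)) z) \<longlonglongrightarrow> dist (Z 0) z"
    by (intro tendsto_intros shift_limit_start Z)
  then have Z0: "dist (Z 0) z \<le> \<delta>"
    by (rule LIMSEQ_le_const2) (use mm(3) in \<open>auto simp: less_imp_le\<close>)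
  then have "Z 0 \<in> domain_of_attraction field z" using \<eta>(2) \<delta>(3) by (auto simp: dist_commute subset_iff)
  from solution_tendsto[OF sol this] have "eventually (\<lambda>T. dist (Z T) z < \<delta>) at_top"
    using \<delta>(1) by (rule tendstoD)
  then have "eventually (\<lambda>T. dist (Z T) z < \<delta> \<and> T > 0) at_top"
    using eventually_gt_at_top[of "0::real"] by eventually_elim auto
  then obtain T where T: "T > 0" "dist (Z T) z < \<delta>"
    using eventually_happens'[OF trivial_limit_at_top_linorder] by blast
  have T0: "T \<ge> 0" using T by simp
  define n where "n l = idx (t ((mm \<circ> \<phi>) l) + T)" for l
  have "(\<lambda>l. dist (x (n l)) z) \<longlonglongrightarrow> dist (Z T) z"
    unfolding n_def by (intro tendsto_intros shift_limit_idx Z T0)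
  then have ev1: "eventually (\<lambda>l. dist (x (n l)) z < \<delta>) sequentially" using T(2) by (rule order_tendstoD)
  have nT: "(\<lambda>l. t (n l) - t ((mm \<circ> \<phi>) l)) \<longlonglongrightarrow> T"
    unfolding n_def using Z T0 by (intro t_idx_shift(1)) (simp_all only: shift_limit_def)
  then have ev2: "eventually (\<lambda>l. t (n l) - t ((mm \<circ> \<phi>) l) > 0) sequentially"
    using T(1) by (rule order_tendstoD)
  define \<tau> where "\<tau> l = t (nn (\<phi> l)) - t (mm (\<phi> l))" for l
  \<comment> \<open>a return to the \<open>\<delta>\<close>-ball after step \<open>mm\<close> can only happen after the exit\<close>
  have "eventually (\<lambda>l. \<tau> l \<in> {0..T}) sequentially"
    using ev1 ev2
  proof eventually_elim
    case (elim l)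
    have "mm (\<phi> l) < n l" using elim(2) t_less_iff[of "mm (\<phi> l)" "n l"] by simp
    then have "nn (\<phi> l) < n l" using mm(5)[of "\<phi> l" "n l"] elim(1) by (meson not_less)
    then have "t (nn (\<phi> l)) \<le> t (n l)" by (simp add: t_le_iff)
    also have "\<dots> \<le> t (mm (\<phi> l)) + T"
      unfolding n_def comp_def using t_nonneg[of "mm (\<phi> l)"] T0 by (intro t_idx_le) simp
    finally show ?case using t_less[OF mm(2)[of "\<phi> l"]] by (simp add: \<tau>_def)
  qed
  then obtain N where N: "\<And>l. \<tau> (l + N) \<in> {0..T}" unfolding eventually_sequentially by (metis le_add2)
  have "seq_compact {0..T}" using compact_Icc compact_eq_seq_compact_metric by blast
  then obtain T' \<psi> where T': "T' \<in> {0..T}" and \<psi>: "strict_mono (\<psi> :: nat \<Rightarrow> nat)"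
    and lim: "((\<lambda>l. \<tau> (l + N)) \<circ> \<psi>) \<longlonglongrightarrow> T'"
    using N unfolding seq_compact_def by meson
  define \<zeta> where "\<zeta> l = \<psi> l + N" for l
  have \<zeta>: "strict_mono \<zeta>" using \<psi> by (simp add: \<zeta>_def strict_mono_def)
  have "(\<lambda>l. t (nn (\<phi> (\<zeta> l))) - t ((mm \<circ> \<phi> \<circ> \<zeta>) l)) \<longlonglongrightarrow> T'"
    using lim by (simp add: \<tau>_def \<zeta>_def comp_def)
  from shift_limit_tendsto(2)[OF shift_limit_subseq[OF Z \<zeta>] _ this] T'
  have "(\<lambda>l. x (nn (\<phi> (\<zeta> l)))) \<longlonglongrightarrow> Z T'" by simp
  then have "(\<lambda>l. dist (x (nn (\<phi> (\<zeta> l)))) z) \<longlonglongrightarrow> dist (Z T') z" by (intro tendsto_intros)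
  then have "dist (Z T') z \<ge> \<epsilon>" by (rule LIMSEQ_le_const) (use mm(4) in auto)
  moreover have "dist (Z T') z < \<epsilon>" using \<delta>0(2)[OF sol] Z0 \<delta>(2) T' by auto
  ultimately show False by simp
qed

end

section \<open>Almost sure convergence of random series\<close>

text \<open>
  The partial sums of \<open>u\<close>, frozen once their modulus reaches \<open>\<epsilon>\<close>. Freezing turns the event that some
  partial sum is large into the event that the last stopped sum is large.
\<close>

primrec stopped_sum :: "real \<Rightarrow> (nat \<Rightarrow> real) \<Rightarrow> nat \<Rightarrow> real" where
  "stopped_sum \<epsilon> u 0 = 0"
| "stopped_sum \<epsilon> u (Suc n) = stopped_sum \<epsilon> u n + (if \<epsilon> \<le> \<bar>stopped_sum \<epsilon> u n\<bar> then 0 else u n)"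

lemma stopped_sum_below:
  "\<epsilon> > 0 \<Longrightarrow> \<bar>stopped_sum \<epsilon> u n\<bar> < \<epsilon> \<Longrightarrow>
     stopped_sum \<epsilon> u n = (\<Sum>k<n. u k) \<and> (\<forall>m\<le>n. \<bar>\<Sum>k<m. u k\<bar> < \<epsilon>)"
  by (induction n) (auto simp: le_Suc_eq split: if_splits)

lemma stopped_sum_cong: "(\<And>k. k < n \<Longrightarrow> u k = u' k) \<Longrightarrow> stopped_sum \<epsilon> u n = stopped_sum \<epsilon> u' n"
  by (induction n) auto

lemma measurable_stopped_sum:
  "{..<n} \<subseteq> I \<Longrightarrow> (\<lambda>u. stopped_sum \<epsilon> u n) \<in> borel_measurable (PiM I (\<lambda>_. borel))"
proof (induction n)
  case (Suc n)
  have [measurable]: "(\<lambda>u. stopped_sum \<epsilon> u n) \<in> borel_measurable (PiM I (\<lambda>_. borel))"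
    using Suc.prems by (intro Suc.IH) auto
  have [measurable]: "(\<lambda>u. u n) \<in> borel_measurable (PiM I (\<lambda>_. borel))"
    using Suc.prems by (intro measurable_component_singleton) auto
  show ?case by simp
qed simp

context prob_space
begin

text \<open>
  While the sum is not frozen, the next term is independent of the past and has mean zero, so the
  mixed term of the square has expectation zero. Its first factor, the stopped sum set to zero after
  freezing, is bounded by \<open>\<epsilon>\<close>, so no integrability question arises.
\<close>

lemma stopped_sum_second_moment:
  fixes X :: "nat \<Rightarrow> 'a \<Rightarrow> real"
  assumes indep: "indep_vars (\<lambda>_. borel) X UNIV"
    and int: "\<And>k. integrable M (\<lambda>\<omega>. (X k \<omega>)\<^sup>2)"
    and mean: "\<And>k. expectation (X k) = 0"
  shows "integrable M (\<lambda>\<omega>. (stopped_sum \<epsilon> (\<lambda>k. X k \<omega>) n)\<^sup>2) \<and>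
         expectation (\<lambda>\<omega>. (stopped_sum \<epsilon> (\<lambda>k. X k \<omega>) n)\<^sup>2) \<le> (\<Sum>k<n. expectation (\<lambda>\<omega>. (X k \<omega>)\<^sup>2))"
proof (induction n)
  case (Suc n)
  have X[measurable]: "random_variable borel (X k)" for k
    using indep by (simp add: indep_vars_def)
  have intX: "integrable M (X k)" for k
    using square_integrable_imp_integrable[OF X int] .
  define T where "T \<omega> = stopped_sum \<epsilon> (\<lambda>k. X k \<omega>) n" for \<omega>
  define c where "c u = (if \<epsilon> \<le> \<bar>stopped_sum \<epsilon> u n\<bar> then 0 else stopped_sum \<epsilon> u n)" for u
  define U where "U \<omega> = c (\<lambda>k. X k \<omega>)" for \<omega>
  have c_eq: "c (restrict u {..<n}) = c u" for u
    unfolding c_def by (simp add: stopped_sum_cong[of n "restrict u {..<n}" u])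
  have [measurable]: "c \<in> borel_measurable (PiM {..<n} (\<lambda>_. borel))"
    unfolding c_def[abs_def] using measurable_stopped_sum[of n "{..<n}" \<epsilon>] by measurable
  have [measurable]: "T \<in> borel_measurable M"
    unfolding T_def[abs_def]
    by (rule measurable_compose[OF measurable_PiM_single' measurable_stopped_sum[of n UNIV \<epsilon>]]) auto
  have "indep_var borel (c \<circ> (\<lambda>\<omega>. restrict (\<lambda>i. X i \<omega>) {..<n}))
      borel ((\<lambda>u. u n) \<circ> (\<lambda>\<omega>. restrict (\<lambda>i. X i \<omega>) {n}))"
    by (rule indep_var_compose[OF indep_var_restrict[OF indep, of "{..<n}" "{n}"]]) auto
  then have ind: "indep_var borel U borel (X n)"
    by (simp add: comp_def c_eq U_def[abs_def])
  have [measurable]: "U \<in> borel_measurable M" using ind by (rule indep_var_rv1)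
  have intU: "integrable M U"
    by (rule integrable_const_bound[of _ "\<bar>\<epsilon>\<bar>"]) (auto simp: U_def c_def)
  have intT: "integrable M (\<lambda>\<omega>. (T \<omega>)\<^sup>2)" using Suc by (simp add: T_def)
  have intUX: "integrable M (\<lambda>\<omega>. U \<omega> * X n \<omega>)"
    and EUX: "expectation (\<lambda>\<omega>. U \<omega> * X n \<omega>) = 0"
    using indep_var_integrable[OF ind intU intX] indep_var_lebesgue_integral[OF ind intU intX] mean[of n]
    by simp_all
  define V where "V \<omega> = (if \<epsilon> \<le> \<bar>T \<omega>\<bar> then 0 else (X n \<omega>)\<^sup>2)" for \<omega>
  have intV: "integrable M V"
    by (rule Bochner_Integration.integrable_bound[OF int[of n]]) (auto simp: V_def[abs_def])
  have eq: "(stopped_sum \<epsilon> (\<lambda>k. X k \<omega>) (Suc n))\<^sup>2 = (T \<omega>)\<^sup>2 + V \<omega> + 2 * (U \<omega> * X n \<omega>)" for \<omega>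
    by (simp add: T_def V_def U_def c_def power2_eq_square algebra_simps)
  have "expectation (\<lambda>\<omega>. (T \<omega>)\<^sup>2 + V \<omega> + 2 * (U \<omega> * X n \<omega>)) = expectation (\<lambda>\<omega>. (T \<omega>)\<^sup>2) + expectation V"
    using intT intV intUX EUX by simp
  also have "\<dots> \<le> (\<Sum>k<n. expectation (\<lambda>\<omega>. (X k \<omega>)\<^sup>2)) + expectation (\<lambda>\<omega>. (X n \<omega>)\<^sup>2)"
    using Suc intV int[of n] by (intro add_mono integral_mono) (auto simp: T_def V_def)
  finally have "expectation (\<lambda>\<omega>. (T \<omega>)\<^sup>2 + V \<omega> + 2 * (U \<omega> * X n \<omega>)) \<le> (\<Sum>k<Suc n. expectation (\<lambda>\<omega>. (X k \<omega>)\<^sup>2))"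
    by simp
  moreover have "integrable M (\<lambda>\<omega>. (T \<omega>)\<^sup>2 + V \<omega> + 2 * (U \<omega> * X n \<omega>))"
    using intT intV intUX by simp
  ultimately show ?case by (simp only: eq)
qed simp

theorem Kolmogorov_maximal_inequality:
  fixes X :: "nat \<Rightarrow> 'a \<Rightarrow> real"
  assumes indep: "indep_vars (\<lambda>_. borel) X UNIV"
    and int: "\<And>k. integrable M (\<lambda>\<omega>. (X k \<omega>)\<^sup>2)"
    and mean: "\<And>k. expectation (X k) = 0"
    and \<epsilon>: "\<epsilon> > 0"
  shows "prob {\<omega> \<in> space M. \<exists>m\<le>n. \<epsilon> \<le> \<bar>\<Sum>k<m. X k \<omega>\<bar>} \<le> (\<Sum>k<n. expectation (\<lambda>\<omega>. (X k \<omega>)\<^sup>2)) / \<epsilon>\<^sup>2"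
proof -
  have X[measurable]: "random_variable borel (X k)" for k
    using indep by (simp add: indep_vars_def)
  define T where "T \<omega> = stopped_sum \<epsilon> (\<lambda>k. X k \<omega>) n" for \<omega>
  have [measurable]: "T \<in> borel_measurable M"
    unfolding T_def[abs_def]
    by (rule measurable_compose[OF measurable_PiM_single' measurable_stopped_sum[of n UNIV \<epsilon>]]) auto
  note T = stopped_sum_second_moment[OF indep int mean, of \<epsilon> n, folded T_def]
  have "prob {\<omega> \<in> space M. \<exists>m\<le>n. \<epsilon> \<le> \<bar>\<Sum>k<m. X k \<omega>\<bar>} \<le> prob {\<omega> \<in> space M. \<epsilon> \<le> \<bar>T \<omega>\<bar>}"
  proof (rule finite_measure_mono)
    show "{\<omega> \<in> space M. \<exists>m\<le>n. \<epsilon> \<le> \<bar>\<Sum>k<m. X k \<omega>\<bar>} \<subseteq> {\<omega> \<in> space M. \<epsilon> \<le> \<bar>T \<omega>\<bar>}"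
      using stopped_sum_below[OF \<epsilon>] by (auto simp: T_def not_less[symmetric])
  qed measurable
  also have "\<dots> \<le> expectation (\<lambda>\<omega>. (T \<omega>)\<^sup>2) / \<epsilon>\<^sup>2"
    using T \<epsilon> by (intro second_moment_method) auto
  also have "\<dots> \<le> (\<Sum>k<n. expectation (\<lambda>\<omega>. (X k \<omega>)\<^sup>2)) / \<epsilon>\<^sup>2"
    using T \<epsilon> by (intro divide_right_mono) auto
  finally show ?thesis .
qed

text \<open>
  An \<open>\<omega>\<close> at which every tail sum oscillates by \<open>\<epsilon>\<close> lies in the event for each \<open>k\<close>, whose
  probabilities tend to zero. Hence almost surely some tail oscillates by less than \<open>\<epsilon>\<close>, which is the Cauchy
  criterion.
\<close>

lemma AE_summable_if_tails_vanish:
  fixes Y :: "nat \<Rightarrow> 'a \<Rightarrow> 'b::euclidean_space"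
  assumes [measurable]: "\<And>k. Y k \<in> borel_measurable M"
    and lim: "\<And>\<epsilon>::real. \<epsilon> > 0 \<Longrightarrow>
      (\<lambda>k. prob {\<omega> \<in> space M. \<exists>m\<ge>k. \<epsilon> \<le> norm (\<Sum>r=k..<m. Y r \<omega>)}) \<longlonglongrightarrow> 0"
  shows "AE \<omega> in M. summable (\<lambda>k. Y k \<omega>)"
proof -
  have "AE \<omega> in M. \<exists>k. \<forall>m\<ge>k. norm (\<Sum>r=k..<m. Y r \<omega>) < \<epsilon>" if \<epsilon>: "\<epsilon> > 0" for \<epsilon>
  proof -
    define B where "B = {\<omega> \<in> space M. \<forall>k. \<exists>m\<ge>k. \<epsilon> \<le> norm (\<Sum>r=k..<m. Y r \<omega>)}"
    have B[measurable]: "B \<in> sets M" unfolding B_def by measurable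
    have "prob B \<le> prob {\<omega> \<in> space M. \<exists>m\<ge>k. \<epsilon> \<le> norm (\<Sum>r=k..<m. Y r \<omega>)}" for k
      by (intro finite_measure_mono) (auto simp: B_def)
    then have "prob B \<le> 0"
      using LIMSEQ_le_const[OF lim[OF \<epsilon>]] by blast
    then have "emeasure M B = 0" by (simp add: emeasure_eq_measure measure_le_0_iff)
    then have "AE \<omega> in M. \<omega> \<notin> B" by (intro AE_not_in) (auto simp: null_sets_def)
    then show ?thesis
      using AE_space
    proof eventually_elim
      case (elim \<omega>)
      then show ?case unfolding B_def by (simp add: not_le[symmetric])
    qed
  qed
  then have "AE \<omega> in M. \<forall>i. \<exists>k. \<forall>m\<ge>k. norm (\<Sum>r=k..<m. Y r \<omega>) < inverse (real (Suc i))"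
    by (intro AE_all_countable[THEN iffD2] allI) simp
  then show ?thesis
  proof eventually_elim
    case (elim \<omega>)
    show ?case unfolding summable_Cauchy
    proof (intro allI impI)
      fix e :: real assume "e > 0"
      then obtain i where i: "inverse (real (Suc i)) < e / 2" using reals_Archimedean[of "e / 2"] by auto
      obtain k where k: "\<And>m. m \<ge> k \<Longrightarrow> norm (\<Sum>r=k..<m. Y r \<omega>) < inverse (real (Suc i))"
        using elim by blast
      show "\<exists>N. \<forall>m\<ge>N. \<forall>n. norm (sum (\<lambda>k. Y k \<omega>) {m..<n}) < e"
      proof (intro exI[of _ k] allI impI)
        fix m n assume m: "m \<ge> k"
        show "norm (sum (\<lambda>k. Y k \<omega>) {m..<n}) < e"
        proof (cases "m \<le> n")
          case True
          have "sum (\<lambda>k. Y k \<omega>) {m..<n} = (\<Sum>r=k..<n. Y r \<omega>) - (\<Sum>r=k..<m. Y r \<omega>)"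
            using sum.atLeastLessThan_concat[OF m True, of "\<lambda>k. Y k \<omega>"] by (simp add: algebra_simps)
          then show ?thesis
            using k[of m] k[of n] m True i
              norm_triangle_ineq4[of "\<Sum>r=k..<n. Y r \<omega>" "\<Sum>r=k..<m. Y r \<omega>"] by simp
        qed (use \<open>e > 0\<close> in simp)
      qed
    qed
  qed
qed

theorem Kolmogorov_convergence_criterion:
  fixes X :: "nat \<Rightarrow> 'a \<Rightarrow> real"
  assumes indep: "indep_vars (\<lambda>_. borel) X UNIV"
    and int: "\<And>k. integrable M (\<lambda>\<omega>. (X k \<omega>)\<^sup>2)"
    and mean: "\<And>k. expectation (X k) = 0"
    and var: "summable (\<lambda>k. expectation (\<lambda>\<omega>. (X k \<omega>)\<^sup>2))"
  shows "AE \<omega> in M. summable (\<lambda>k. X k \<omega>)"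
proof (rule AE_summable_if_tails_vanish)
  show X[measurable]: "random_variable borel (X k)" for k
    using indep by (simp add: indep_vars_def)
  fix \<epsilon> :: real assume \<epsilon>: "\<epsilon> > 0"
  define \<sigma> where "\<sigma> k = expectation (\<lambda>\<omega>. (X k \<omega>)\<^sup>2)" for k
  have \<sigma>: "\<sigma> k \<ge> 0" for k by (simp add: \<sigma>_def)
  have sm: "summable \<sigma>" using var by (simp add: \<sigma>_def[abs_def])
  have bound: "prob {\<omega> \<in> space M. \<exists>m\<ge>k. \<epsilon> \<le> norm (\<Sum>r=k..<m. X r \<omega>)} \<le> (suminf \<sigma> - (\<Sum>i<k. \<sigma> i)) / \<epsilon>\<^sup>2" for k
  proof -
    \<comment> \<open>zeroing the first \<open>k\<close> terms reduces the tail to an initial segment\<close>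
    define X' where "X' i \<omega> = (if i < k then 0 else X i \<omega>)" for i \<omega>
    have ind': "indep_vars (\<lambda>_. borel) X' UNIV"
      unfolding X'_def by (rule indep_vars_compose2[OF indep, of "\<lambda>i x. if i < k then 0 else x"]) auto
    have sum': "(\<Sum>i<m. X' i \<omega>) = (\<Sum>r=k..<m. X r \<omega>)" for m \<omega>
    proof -
      have "(\<Sum>i<m. X' i \<omega>) = (\<Sum>i\<in>{..<m} - {..<k}. X i \<omega>)"
        unfolding X'_def by (rule sum.mono_neutral_cong_right) auto
      also have "{..<m} - {..<k} = {k..<m}" by auto
      finally show ?thesis .
    qed
    have "prob {\<omega> \<in> space M. \<exists>m\<le>n. \<epsilon> \<le> \<bar>\<Sum>r=k..<m. X r \<omega>\<bar>} \<le> (suminf \<sigma> - (\<Sum>i<k. \<sigma> i)) / \<epsilon>\<^sup>2" for n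
    proof -
      have i': "integrable M (\<lambda>\<omega>. (X' i \<omega>)\<^sup>2)" and e': "expectation (X' i) = 0"
        and s': "expectation (\<lambda>\<omega>. (X' i \<omega>)\<^sup>2) = (if i < k then 0 else \<sigma> i)" for i
      proof -
        have "X' i = (if i < k then (\<lambda>_. 0) else X i)" by (auto simp: X'_def)
        then show "integrable M (\<lambda>\<omega>. (X' i \<omega>)\<^sup>2)" "expectation (X' i) = 0"
          "expectation (\<lambda>\<omega>. (X' i \<omega>)\<^sup>2) = (if i < k then 0 else \<sigma> i)"
          using int[of i] mean[of i] by (simp_all add: \<sigma>_def)
      qed
      from Kolmogorov_maximal_inequality[OF ind' i' e' \<epsilon>, of n]
      have "prob {\<omega> \<in> space M. \<exists>m\<le>n. \<epsilon> \<le> \<bar>\<Sum>r=k..<m. X r \<omega>\<bar>} \<le> (\<Sum>i<n. if i < k then 0 else \<sigma> i) / \<epsilon>\<^sup>2"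
        by (simp add: sum' s')
      also have "(\<Sum>i<n. if i < k then 0 else \<sigma> i) = (\<Sum>i\<in>{..<n} - {..<k}. \<sigma> i)"
        by (rule sum.mono_neutral_cong_right) auto
      also have "\<dots> = (\<Sum>i\<in>{..<n} \<union> {..<k}. \<sigma> i) - (\<Sum>i<k. \<sigma> i)"
        using sum.subset_diff[of "{..<k}" "{..<n} \<union> {..<k}" \<sigma>] by (simp add: Un_Diff)
      also have "(\<Sum>i\<in>{..<n} \<union> {..<k}. \<sigma> i) \<le> suminf \<sigma>"
        using sm \<sigma> by (intro sum_le_suminf) auto
      finally show ?thesis using \<epsilon> by (simp add: divide_right_mono)
    qed
    moreover have "(\<lambda>n. prob {\<omega> \<in> space M. \<exists>m\<le>n. \<epsilon> \<le> \<bar>\<Sum>r=k..<m. X r \<omega>\<bar>}) \<longlonglongrightarrow>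
        prob (\<Union>n. {\<omega> \<in> space M. \<exists>m\<le>n. \<epsilon> \<le> \<bar>\<Sum>r=k..<m. X r \<omega>\<bar>})"
      by (intro finite_Lim_measure_incseq) (auto simp: incseq_def intro: order_trans)
    ultimately have "prob (\<Union>n. {\<omega> \<in> space M. \<exists>m\<le>n. \<epsilon> \<le> \<bar>\<Sum>r=k..<m. X r \<omega>\<bar>}) \<le> (suminf \<sigma> - (\<Sum>i<k. \<sigma> i)) / \<epsilon>\<^sup>2"
      by (intro LIMSEQ_le_const2) auto
    moreover have "prob {\<omega> \<in> space M. \<exists>m\<ge>k. \<epsilon> \<le> norm (\<Sum>r=k..<m. X r \<omega>)} \<le>
        prob (\<Union>n. {\<omega> \<in> space M. \<exists>m\<le>n. \<epsilon> \<le> \<bar>\<Sum>r=k..<m. X r \<omega>\<bar>})"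
      by (intro finite_measure_mono) auto
    ultimately show ?thesis by linarith
  qed
  have "(\<lambda>k. (suminf \<sigma> - (\<Sum>i<k. \<sigma> i)) / \<epsilon>\<^sup>2) \<longlonglongrightarrow> (suminf \<sigma> - suminf \<sigma>) / \<epsilon>\<^sup>2"
    using \<epsilon> by (intro tendsto_divide tendsto_diff tendsto_const summable_LIMSEQ sm) auto
  then have "(\<lambda>k. (suminf \<sigma> - (\<Sum>i<k. \<sigma> i)) / \<epsilon>\<^sup>2) \<longlonglongrightarrow> 0" by simp
  then show "(\<lambda>k. prob {\<omega> \<in> space M. \<exists>m\<ge>k. \<epsilon> \<le> norm (\<Sum>r=k..<m. X r \<omega>)}) \<longlonglongrightarrow> 0"
    by (rule Lim_null_comparison[rotated]) (use bound in \<open>simp add: always_eventually\<close>)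
qed

end

section \<open>Selection frequencies and gain ratios\<close>

text \<open>
  The strong law of large numbers for bounded variables: the probabilities in Hoeffding's inequality
  decay geometrically, so the Borel-Cantelli lemma applies.
\<close>

lemma (in prob_space) AE_frequency_tendsto:
  fixes X :: "nat \<Rightarrow> 'a \<Rightarrow> real"
  assumes indep: "indep_vars (\<lambda>_. borel) X UNIV"
    and range: "\<And>k. AE \<omega> in M. X k \<omega> \<in> {0..1}"
    and mean: "\<And>k. expectation (X k) = p"
  shows "AE \<omega> in M. (\<lambda>n. (\<Sum>k<n. X k \<omega>) / real n) \<longlonglongrightarrow> p"
proof -
  have [measurable]: "random_variable borel (X k)" for k
    using indep by (simp add: indep_vars_def)
  have "AE \<omega> in M. eventually (\<lambda>n. \<bar>(\<Sum>k<n. X k \<omega>) / real n - p\<bar> < \<epsilon>) sequentially" if \<epsilon>: "\<epsilon> > 0" for \<epsilon>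
  proof -
    define A where "A n = {\<omega> \<in> space M. real n * \<epsilon> \<le> \<bar>(\<Sum>k<n. X k \<omega>) - real n * p\<bar>}" for n
    have [measurable]: "A n \<in> sets M" for n unfolding A_def by measurable
    have bound: "prob (A n) \<le> 2 * exp (- 2 * \<epsilon>\<^sup>2) ^ n" for n
    proof (cases "n = 0")
      case False
      interpret Hoeffding_ineq M "{..<n}" X "\<lambda>_. 0" "\<lambda>_. 1" "\<Sum>k<n. expectation (X k)"
        using indep_vars_subset[OF indep, of "{..<n}"] range by unfold_locales simp_all
      have "prob (A n) \<le> 2 * exp (- 2 * (real n * \<epsilon>)\<^sup>2 / real n)"
        using Hoeffding_ineq_abs_ge[of "real n * \<epsilon>"] \<epsilon> False by (simp add: A_def mean)
      also have "- 2 * (real n * \<epsilon>)\<^sup>2 / real n = real n * (- 2 * \<epsilon>\<^sup>2)"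
        using False by (simp add: power2_eq_square)
      also have "exp \<dots> = exp (- 2 * \<epsilon>\<^sup>2) ^ n" by (rule exp_of_nat_mult)
      finally show ?thesis .
    qed (auto intro: order_trans[OF prob_le_1])
    have "summable (\<lambda>n. 2 * exp (- 2 * \<epsilon>\<^sup>2) ^ n)"
      using \<epsilon> by (intro summable_mult summable_geometric) simp
    then have "summable (\<lambda>n. prob (A n))"
      by (rule summable_comparison_test'[where N = 0]) (use bound in simp)
    then have "AE \<omega> in M. eventually (\<lambda>n. \<omega> \<in> space M - A n) sequentially"
      by (intro borel_cantelli_AE1) (auto simp: emeasure_eq_measure)
    then show ?thesis
    proof eventually_elim
      case (elim \<omega>)
      then show ?case using eventually_gt_at_top[of 0]
      proof eventually_elim
        case (elim n)
        then have "\<bar>(\<Sum>k<n. X k \<omega>) - real n * p\<bar> < real n * \<epsilon>" by (auto simp: A_def)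
        moreover have "(\<Sum>k<n. X k \<omega>) / real n - p = ((\<Sum>k<n. X k \<omega>) - real n * p) / real n"
          using elim by (simp add: field_simps)
        ultimately show ?case using elim by (simp add: abs_divide pos_divide_less_eq mult.commute)
      qed
    qed
  qed
  then have "AE \<omega> in M. \<forall>i. eventually (\<lambda>n. \<bar>(\<Sum>k<n. X k \<omega>) / real n - p\<bar> < inverse (real (Suc i))) sequentially"
    by (intro AE_all_countable[THEN iffD2] allI) simp
  then show ?thesis
  proof eventually_elim
    case (elim \<omega>)
    show ?case
    proof (rule tendstoI)
      fix e :: real assume "e > 0"
      then obtain i where i: "inverse (real (Suc i)) < e" using reals_Archimedean by auto
      from elim[rule_format, of i]
      show "eventually (\<lambda>n. dist ((\<Sum>k<n. X k \<omega>) / real n) p < e) sequentially"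
        by eventually_elim (use i in \<open>simp add: dist_real_def\<close>)
    qed
  qed
qed

text \<open>
  The counter \<open>N k\<close> is eventually between \<open>k * (p - \<epsilon>)\<close> and \<open>k * (p + \<epsilon>)\<close>, and \<open>b\<close> is decreasing, so the
  gain that is in use is squeezed between two gains at deterministic positions. It remains to
  let \<open>\<epsilon>\<close> tend to zero.
\<close>

lemma gain_ratio_tendsto:
  fixes a b R :: "_ \<Rightarrow> real" and N :: "nat \<Rightarrow> nat"
  assumes freq: "(\<lambda>k. real (N k) / real k) \<longlonglongrightarrow> p"
    and a_pos: "\<And>k. a k > 0" and b_decr: "\<And>m n. m \<le> n \<Longrightarrow> b n \<le> b m" and "\<delta> > 0"
    and lower: "\<And>\<epsilon>. 0 < \<epsilon> \<Longrightarrow> \<epsilon> \<le> \<delta> \<Longrightarrow> (\<lambda>k. b (nat \<lfloor>real k * (p - \<epsilon>)\<rfloor>) / a k) \<longlonglongrightarrow> R (p - \<epsilon>)"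
    and upper: "\<And>\<epsilon>. 0 < \<epsilon> \<Longrightarrow> \<epsilon> \<le> \<delta> \<Longrightarrow> (\<lambda>k. b (nat \<lceil>real k * (p + \<epsilon>)\<rceil>) / a k) \<longlonglongrightarrow> R (p + \<epsilon>)"
    and left: "((\<lambda>\<epsilon>. R (p - \<epsilon>)) \<longlongrightarrow> R p) (at_right 0)"
    and right: "((\<lambda>\<epsilon>. R (p + \<epsilon>)) \<longlongrightarrow> R p) (at_right 0)"
  shows "(\<lambda>k. b (N k) / a k) \<longlonglongrightarrow> R p"
proof (rule order_tendstoI)
  have small: "\<exists>\<epsilon>. 0 < \<epsilon> \<and> \<epsilon> \<le> \<delta> \<and> P \<epsilon>" if P: "eventually P (at_right 0)" for P
  proof -
    have "eventually (\<lambda>\<epsilon>. \<epsilon> \<in> {0<..<\<delta>}) (at_right 0)"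
      using \<open>\<delta> > 0\<close> by (rule eventually_at_right_real)
    with P have "eventually (\<lambda>\<epsilon>. P \<epsilon> \<and> \<epsilon> \<in> {0<..<\<delta>}) (at_right 0)" by (rule eventually_conj)
    then show ?thesis using eventually_happens'[OF trivial_limit_at_right_real] by force
  qed
  {
    fix l assume "l < R p"
    then obtain \<epsilon> where \<epsilon>: "0 < \<epsilon>" "\<epsilon> \<le> \<delta>" "l < R (p + \<epsilon>)"
      using small[OF order_tendstoD(1)[OF right]] by blast
    from order_tendstoD(1)[OF upper[OF \<epsilon>(1,2)] \<epsilon>(3)] order_tendstoD(2)[OF freq, of "p + \<epsilon>"] \<epsilon>(1)
    have "eventually (\<lambda>k. l < b (nat \<lceil>real k * (p + \<epsilon>)\<rceil>) / a k \<and> real (N k) / real k < p + \<epsilon> \<and> k > 0) sequentially"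
      by (intro eventually_conj eventually_gt_at_top) auto
    then show "eventually (\<lambda>k. l < b (N k) / a k) sequentially"
    proof eventually_elim
      case (elim k)
      then have "real k > 0" "real (N k) / real k < p + \<epsilon>" by auto
      then have "real (N k) \<le> real k * (p + \<epsilon>)" by (simp add: pos_divide_less_eq mult.commute)
      then have "N k \<le> nat \<lceil>real k * (p + \<epsilon>)\<rceil>" by linarith
      from divide_right_mono[OF b_decr[OF this] less_imp_le[OF a_pos[of k]]] elim show ?case by linarith
    qed
  next
    fix l assume "R p < l"
    then obtain \<epsilon> where \<epsilon>: "0 < \<epsilon>" "\<epsilon> \<le> \<delta>" "R (p - \<epsilon>) < l"
      using small[OF order_tendstoD(2)[OF left]] by blast
    from order_tendstoD(2)[OF lower[OF \<epsilon>(1,2)] \<epsilon>(3)] order_tendstoD(1)[OF freq, of "p - \<epsilon>"] \<epsilon>(1)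
    have "eventually (\<lambda>k. b (nat \<lfloor>real k * (p - \<epsilon>)\<rfloor>) / a k < l \<and> p - \<epsilon> < real (N k) / real k \<and> k > 0) sequentially"
      by (intro eventually_conj eventually_gt_at_top) auto
    then show "eventually (\<lambda>k. b (N k) / a k < l) sequentially"
    proof eventually_elim
      case (elim k)
      then have "real k > 0" "p - \<epsilon> < real (N k) / real k" by auto
      then have "real k * (p - \<epsilon>) \<le> real (N k)" by (simp add: pos_less_divide_eq mult.commute)
      then have "nat \<lfloor>real k * (p - \<epsilon>)\<rfloor> \<le> N k" by linarith
      from divide_right_mono[OF b_decr[OF this] less_imp_le[OF a_pos[of k]]] elim show ?case by linarith
    qed
  }
qed

section \<open>Randomized subvector selection\<close>

lemma norm_subvec_le: "norm (subvec S v) \<le> norm v"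
  unfolding norm_vec_def subvec_def by (intro L2_set_mono) auto

lemma linear_subvec: "linear (subvec S)"
  by (rule linearI) (auto simp: subvec_def vec_eq_iff)

lemma borel_measurable_subvec [measurable]: "subvec S \<in> borel_measurable borel"
  by (intro borel_measurable_continuous_onI linear_continuous_on linear_conv_bounded_linear[THEN iffD1] linear_subvec)

text \<open>
  The events that speak about the accumulated noise are measurable because the selection counts are.
\<close>

lemma (in prob_space) gain_times_subvec_measurable:
  assumes J: "\<And>k. J k \<in> measurable M (count_space {1..d})" and \<xi>: "\<xi> \<in> borel_measurable M"
  shows "(\<lambda>\<omega>. a r *\<^sub>R ((next_gain aj (\<lambda>i. J i \<omega>) r (J r \<omega>) / a r) *\<^sub>R subvec (S (J r \<omega>)) (\<xi> \<omega>)))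
      \<in> borel_measurable M"
proof -
  note [measurable] = \<xi> J
  have [measurable]: "Measurable.pred M (\<lambda>\<omega>. J i \<omega> = j)" for i j
    by (rule measurable_compose[OF J[of i]]) simp
  have N: "(\<lambda>\<omega>. card {i. i < r \<and> J i \<omega> = j}) \<in> measurable M (count_space UNIV)" for j
  proof -
    have "card {i. i < r \<and> J i \<omega> = j} = (\<Sum>i<r. if J i \<omega> = j then 1 else 0)" for \<omega>
      by (simp add: sum.If_cases Int_def Collect_conj_eq[symmetric])
    then show ?thesis by simp
  qed
  have gain: "(\<lambda>\<omega>. next_gain aj (\<lambda>i. J i \<omega>) r j) \<in> borel_measurable M" for j
    unfolding next_gain_def by (rule measurable_compose[OF N borel_measurable_count_space])
  have "(\<lambda>\<omega>. a r *\<^sub>R ((next_gain aj (\<lambda>i. J i \<omega>) r j / a r) *\<^sub>R subvec (S j) (\<xi> \<omega>))) \<in> borel_measurable M" for j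
    using gain[of j] by measurable
  then show ?thesis
    by (intro measurable_compose_countable'[where f = "\<lambda>j \<omega>. a r *\<^sub>R ((next_gain aj (\<lambda>i. J i \<omega>) r j / a r) *\<^sub>R subvec (S j) (\<xi> \<omega>))", OF _ J[of r]]) auto
qed

text \<open>
  One path of the algorithm, with \<open>c k j\<close> the ratio of the current gain of block \<open>j\<close> to \<open>a k\<close>. Replacing
  \<open>c k j\<close> by its limit and dropping the bias changes each step by \<open>a k\<close> times a vanishing error, which leaves
  a recursion that switches between the fields \<open>- \<rho> j *\<^sub>R subvec (S j) (g z)\<close>.
\<close>

lemma subvec_recursion_tendsto:
  fixes x \<beta> \<xi> :: "nat \<Rightarrow> real ^ 'p::finite" and g :: "real ^ 'p \<Rightarrow> real ^ 'p" and c :: "nat \<Rightarrow> nat \<Rightarrow> real"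
  assumes a_pos: "\<And>k. a k > 0"
    and a_lim: "a \<longlonglongrightarrow> 0"
    and a_sum: "filterlim (\<lambda>n. \<Sum>k<n. a k) at_top sequentially"
    and js: "\<And>k. js k \<in> {1..d}"
    and js_average: "\<And>j. j \<in> {1..d} \<Longrightarrow> summable (\<lambda>k. a k * (of_bool (js k = j) - q j))"
    and c_lim: "\<And>j. j \<in> {1..d} \<Longrightarrow> (\<lambda>k. c k j) \<longlonglongrightarrow> \<rho> j"
    and g_cont: "continuous_on UNIV g"
    and x_bounded: "bounded (range x)"
    and \<beta>_lim: "(\<lambda>k. subvec (S (js k)) (\<beta> k)) \<longlonglongrightarrow> 0"
    and noise: "summable (\<lambda>k. a k *\<^sub>R (c k (js k) *\<^sub>R subvec (S (js k)) (\<xi> k)))"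
    and rec: "\<And>k. x (Suc k) = x k - (a k * c k (js k)) *\<^sub>R subvec (S (js k)) (g (x k) + \<beta> k + \<xi> k)"
    and stable: "locally_asymptotically_stable (\<lambda>z. - (\<Sum>j\<in>{1..d}. (q j * \<rho> j) *\<^sub>R subvec (S j) (g z))) z"
    and A: "compact A" "A \<subseteq> domain_of_attraction (\<lambda>z. - (\<Sum>j\<in>{1..d}. (q j * \<rho> j) *\<^sub>R subvec (S j) (g z))) z"
    and io: "\<exists>\<^sub>\<infinity>k. x k \<in> A"
  shows "x \<longlonglongrightarrow> z"
proof -
  define h where "h j u = - (\<rho> j *\<^sub>R subvec (S j) (g u))" for j u
  define r where "r k = - ((c k (js k) - \<rho> (js k)) *\<^sub>R subvec (S (js k)) (g (x k)) +
      c k (js k) *\<^sub>R subvec (S (js k)) (\<beta> k))" for k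
  define e where "e k = - (a k *\<^sub>R (c k (js k) *\<^sub>R subvec (S (js k)) (\<xi> k)))" for k
  define \<eta> where "\<eta> k = (\<Sum>j\<in>{1..d}. \<bar>c k j - \<rho> j\<bar>)" for k
  define P where "P = (\<Sum>j\<in>{1..d}. \<bar>\<rho> j\<bar>)"
  have \<eta>_lim: "\<eta> \<longlonglongrightarrow> 0"
  proof -
    have "\<eta> \<longlonglongrightarrow> (\<Sum>j\<in>{1..d}. \<bar>\<rho> j - \<rho> j\<bar>)"
      unfolding \<eta>_def by (intro tendsto_sum tendsto_rabs tendsto_diff tendsto_const c_lim)
    then show ?thesis by simp
  qed
  have c1: "\<bar>c k (js k) - \<rho> (js k)\<bar> \<le> \<eta> k" for k
    unfolding \<eta>_def using js[of k] by (intro member_le_sum[of "js k" _ "\<lambda>j. \<bar>c k j - \<rho> j\<bar>"]) auto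
  have "\<bar>\<rho> (js k)\<bar> \<le> P" for k
    unfolding P_def using js[of k] by (intro member_le_sum[of "js k" _ "\<lambda>j. \<bar>\<rho> j\<bar>"]) auto
  then have c2: "\<bar>c k (js k)\<bar> \<le> \<eta> k + P" for k
    using c1[of k] by (smt (verit))
  obtain B where B: "\<And>k. norm (x k) \<le> B" using x_bounded by (auto simp: bounded_iff)
  have "compact (g ` cball 0 B)"
    using continuous_on_subset[OF g_cont] by (intro compact_continuous_image) auto
  then obtain G where "\<forall>u\<in>g ` cball 0 B. norm u \<le> G"
    using compact_imp_bounded bounded_iff by blast
  then have G: "norm (g (x k)) \<le> G" for k using B by auto
  have r_bound: "norm (r k) \<le> \<eta> k * G + (\<eta> k + P) * norm (subvec (S (js k)) (\<beta> k))" for k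
  proof -
    have "norm (r k) \<le> \<bar>c k (js k) - \<rho> (js k)\<bar> * norm (subvec (S (js k)) (g (x k))) +
        \<bar>c k (js k)\<bar> * norm (subvec (S (js k)) (\<beta> k))"
      unfolding r_def norm_minus_cancel by (rule norm_triangle_mono) simp_all
    also have "\<dots> \<le> \<eta> k * G + (\<eta> k + P) * norm (subvec (S (js k)) (\<beta> k))"
      using c1[of k] c2[of k] order_trans[OF norm_subvec_le G, of "S (js k)" k]
      by (intro add_mono mult_mono) auto
    finally show ?thesis .
  qed
  have "(\<lambda>k. \<eta> k * G + (\<eta> k + P) * norm (subvec (S (js k)) (\<beta> k))) \<longlonglongrightarrow> 0 * G + (0 + P) * norm (0 :: real ^ 'p)"
    by (intro tendsto_add tendsto_mult tendsto_norm tendsto_const \<eta>_lim \<beta>_lim)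
  then have bound_lim: "(\<lambda>k. \<eta> k * G + (\<eta> k + P) * norm (subvec (S (js k)) (\<beta> k))) \<longlonglongrightarrow> 0" by simp
  have r_lim: "r \<longlonglongrightarrow> 0"
    by (rule Lim_null_comparison[OF _ bound_lim]) (use r_bound in \<open>simp add: always_eventually\<close>)
  have h_cont: "continuous_on UNIV (h j)" for j
    unfolding h_def
    by (intro continuous_intros linear_continuous_on_compose[OF g_cont linear_subvec])
  interpret perturbed_recursion a "{1..d}" "\<lambda>k j. of_bool (js k = j)" q h r e x
  proof
    show "x (Suc k) = x k + a k *\<^sub>R ((\<Sum>j\<in>{1..d}. of_bool (js k = j) *\<^sub>R h j (x k)) + r k) + e k" for k
    proof -
      have "(\<Sum>j\<in>{1..d}. of_bool (js k = j) *\<^sub>R h j (x k)) = (\<Sum>j\<in>{1..d}. if js k = j then h j (x k) else 0)"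
        by (intro sum.cong) auto
      also have "\<dots> = h (js k) (x k)" using js[of k] by simp
      finally show ?thesis
        by (simp add: rec r_def e_def h_def linear_add[OF linear_subvec] algebra_simps)
    qed
  qed (use a_pos a_lim a_sum js_average h_cont r_lim x_bounded noise in
      \<open>simp_all add: e_def[abs_def] summable_minus\<close>)
  have "field = (\<lambda>z. - (\<Sum>j\<in>{1..d}. (q j * \<rho> j) *\<^sub>R subvec (S j) (g z)))"
  proof
    fix u
    show "field u = - (\<Sum>j\<in>{1..d}. (q j * \<rho> j) *\<^sub>R subvec (S j) (g u))"
      unfolding field_def h_def by (simp add: sum_negf)
  qed
  then show ?thesis using converges[of z A] stable A io by simp
qed

text \<open>
  The two ways in which the selections average out. The unweighted frequencies fix the gain ratios. The
  weighted series supplies the averaging over time windows; it does not follow from the frequencies,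
  since a window of bounded total gain is a vanishing fraction of all steps if, say,
  \<open>a k\<close> decays like \<open>k\<close> to the power \<open>-2/3\<close>. It converges because its variances are at
  most \<open>(a k)\<^sup>2\<close>.
\<close>

lemma (in prob_space)
  assumes J: "indep_vars (\<lambda>_. count_space {1..d}) J UNIV"
    and dist: "\<And>k. prob {\<omega> \<in> space M. J k \<omega> = j} = p"
    and a: "summable (\<lambda>k. (a k)\<^sup>2)"
  shows AE_selection_average_summable: "AE \<omega> in M. summable (\<lambda>k. a k * (of_bool (J k \<omega> = j) - p))"
    and AE_selection_frequency: "AE \<omega> in M. (\<lambda>n. real (card {i. i < n \<and> J i \<omega> = j}) / real n) \<longlonglongrightarrow> p"
proof -
  have Jm: "J k \<in> measurable M (count_space {1..d})" for k
    using J by (simp add: indep_vars_def)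
  define X where "X k \<omega> = (of_bool (J k \<omega> = j) :: real)" for k \<omega>
  have indX: "indep_vars (\<lambda>_. borel) X UNIV"
    unfolding X_def by (rule indep_vars_compose2[OF J, of "\<lambda>_ x. of_bool (x = j)"]) auto
  then have [measurable]: "random_variable borel (X k)" for k by (simp add: indep_vars_def)
  have intX: "integrable M (X k)" for k
    by (rule integrable_const_bound[of _ 1]) (auto simp: X_def)
  have meanX: "expectation (X k) = p" for k
  proof -
    have [measurable]: "{\<omega> \<in> space M. J k \<omega> = j} \<in> sets M"
    proof -
      have "{\<omega> \<in> space M. J k \<omega> = j} = {\<omega> \<in> space M. X k \<omega> = 1}" by (auto simp: X_def)
      then show ?thesis by simp
    qed
    have "expectation (X k) = expectation (indicator {\<omega> \<in> space M. J k \<omega> = j})"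
      by (intro Bochner_Integration.integral_cong) (auto simp: X_def indicator_def)
    then show ?thesis using dist[of k] by simp
  qed
  have "AE \<omega> in M. (\<lambda>n. (\<Sum>k<n. X k \<omega>) / real n) \<longlonglongrightarrow> p"
    by (rule AE_frequency_tendsto[OF indX _ meanX]) (simp add: X_def)
  moreover have "(\<Sum>k<n. X k \<omega>) = real (card {i. i < n \<and> J i \<omega> = j})" for n \<omega>
    by (simp add: X_def of_bool_def sum.If_cases Int_def Collect_conj_eq[symmetric])
  ultimately show "AE \<omega> in M. (\<lambda>n. real (card {i. i < n \<and> J i \<omega> = j}) / real n) \<longlonglongrightarrow> p" by simp
  define W where "W k \<omega> = a k * (X k \<omega> - p)" for k \<omega>
  have p: "0 \<le> p" "p \<le> 1" using dist[of 0] prob_le_1 measure_nonneg by metis+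
  have W_bound: "(W k \<omega>)\<^sup>2 \<le> (a k)\<^sup>2" for k \<omega>
  proof -
    have "(X k \<omega> - p)\<^sup>2 \<le> 1\<^sup>2" using p by (intro power2_le_iff_abs_le[THEN iffD2]) (auto simp: X_def)
    then show ?thesis by (simp add: W_def power_mult_distrib mult_left_le)
  qed
  have "AE \<omega> in M. summable (\<lambda>k. W k \<omega>)"
  proof (rule Kolmogorov_convergence_criterion)
    show "indep_vars (\<lambda>_. borel) W UNIV"
      unfolding W_def by (rule indep_vars_compose2[OF indX, of "\<lambda>k x. a k * (x - p)"]) auto
    then have [measurable]: "random_variable borel (W k)" for k by (simp add: indep_vars_def)
    show int: "integrable M (\<lambda>\<omega>. (W k \<omega>)\<^sup>2)" for k
      by (rule integrable_const_bound[of _ "(a k)\<^sup>2"]) (use W_bound in auto)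
    show "expectation (W k) = 0" for k
      using intX[of k] meanX[of k] by (simp add: W_def[abs_def] prob_space)
    have "expectation (\<lambda>\<omega>. (W k \<omega>)\<^sup>2) \<le> (a k)\<^sup>2" for k
      using integral_mono[OF int[of k], of "\<lambda>_. (a k)\<^sup>2"] W_bound by (simp add: prob_space)
    then show "summable (\<lambda>k. expectation (\<lambda>\<omega>. (W k \<omega>)\<^sup>2))"
      by (intro summable_comparison_test'[OF a, of 0]) simp
  qed
  then show "AE \<omega> in M. summable (\<lambda>k. a k * (of_bool (J k \<omega> = j) - p))"
    by (simp add: W_def X_def)
qed

theorem corollary2:
  fixes M :: "'w measure"
    and L :: "real ^ 'p::finite \<Rightarrow> real" and g :: "real ^ 'p \<Rightarrow> real ^ 'p"
    and d :: nat and S :: "nat \<Rightarrow> 'p set"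
    and a :: "nat \<Rightarrow> real" and aj :: "nat \<Rightarrow> nat \<Rightarrow> real"
    and q :: "nat \<Rightarrow> real" and J :: "nat \<Rightarrow> 'w \<Rightarrow> nat"
    and \<theta> :: "nat \<Rightarrow> 'w \<Rightarrow> real ^ 'p" and \<theta>star :: "real ^ 'p"
    and ghat \<beta> \<xi> :: "nat \<Rightarrow> real ^ 'p \<Rightarrow> 'w \<Rightarrow> real ^ 'p"
    and F :: "nat \<Rightarrow> 'w measure"
    and \<rho> :: "nat \<Rightarrow> real \<Rightarrow> real" and C \<epsilon>0 :: real
    and A :: "(real ^ 'p) set"
  assumes prob: "prob_space M"
    and grad: "\<And>x. GDERIV L x :> g x"
    and S_Union: "(\<Union>i\<in>{1..d}. S i) = UNIV"
    and S_Inter: "(\<Inter>i\<in>{1..d}. S i) = {}"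
    and J_indep: "prob_space.indep_vars M (\<lambda>_. count_space {1..d}) J UNIV"
    and J_dist: "\<And>k j. j \<in> {1..d} \<Longrightarrow> measure M {\<omega> \<in> space M. J k \<omega> = j} = q j"
    and q_nonzero: "\<And>j. j \<in> {1..d} \<Longrightarrow> q j \<noteq> 0"
    and q_sum: "(\<Sum>j\<in>{1..d}. q j) = 1"
    and F_sub: "\<And>k. subalgebra M (F k)"
    and \<theta>_meas: "\<And>k. \<theta> k \<in> borel_measurable (F k)"
    and decomp: "\<And>k. AE \<omega> in M.
          ghat k (\<theta> k \<omega>) \<omega> = g (\<theta> k \<omega>) + \<beta> k (\<theta> k \<omega>) \<omega> + \<xi> k (\<theta> k \<omega>) \<omega>"
    and bias: "\<And>k. is_cond_exp M (F k) (\<lambda>\<omega>. ghat k (\<theta> k \<omega>) \<omega> - g (\<theta> k \<omega>)) (\<lambda>\<omega>. \<beta> k (\<theta> k \<omega>) \<omega>)"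
    and noise: "\<And>k. is_cond_exp M (F k) (\<lambda>\<omega>. ghat k (\<theta> k \<omega>) \<omega>)
          (\<lambda>\<omega>. ghat k (\<theta> k \<omega>) \<omega> - \<xi> k (\<theta> k \<omega>) \<omega>)"
    and algorithm: "\<And>k \<omega>. \<omega> \<in> space M \<Longrightarrow>
          \<theta> (Suc k) \<omega> = \<theta> k \<omega> -
            next_gain aj (\<lambda>i. J i \<omega>) k (J k \<omega>) *\<^sub>R subvec (S (J k \<omega>)) (ghat k (\<theta> k \<omega>) \<omega>)"
    and a_pos: "\<And>k. a k > 0"
    and aj_pos: "\<And>j k. j \<in> {1..d} \<Longrightarrow> aj j k > 0"
    and a_sum: "filterlim (\<lambda>n. \<Sum>k<n. a k) at_top sequentially"
    and a_sqsum: "summable (\<lambda>k. (a k)\<^sup>2)"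
    and a_decr: "\<And>m n. m < n \<Longrightarrow> a n < a m"
    and aj_decr: "\<And>j m n. j \<in> {1..d} \<Longrightarrow> m < n \<Longrightarrow> aj j n < aj j m"
    and aj_lim: "\<And>j. j \<in> {1..d} \<Longrightarrow> aj j \<longlonglongrightarrow> 0"
    and \<epsilon>0_pos: "\<epsilon>0 > 0"
    and \<epsilon>0_range: "\<And>j. j \<in> {1..d} \<Longrightarrow> q j - \<epsilon>0 > 0 \<and> q j + \<epsilon>0 \<le> 1"
    and \<rho>_lower: "\<And>j \<epsilon>. j \<in> {1..d} \<Longrightarrow> 0 < \<epsilon> \<Longrightarrow> \<epsilon> \<le> \<epsilon>0 \<Longrightarrow>
          (\<lambda>k. aj j (nat \<lfloor>real k * (q j - \<epsilon>)\<rfloor>) / a k) \<longlonglongrightarrow> \<rho> j (q j - \<epsilon>)"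
    and \<rho>_upper: "\<And>j \<epsilon>. j \<in> {1..d} \<Longrightarrow> 0 < \<epsilon> \<Longrightarrow> \<epsilon> \<le> \<epsilon>0 \<Longrightarrow>
          (\<lambda>k. aj j (nat \<lceil>real k * (q j + \<epsilon>)\<rceil>) / a k) \<longlonglongrightarrow> \<rho> j (q j + \<epsilon>)"
    and \<rho>_bounds: "\<And>j \<epsilon>. j \<in> {1..d} \<Longrightarrow> 0 < \<epsilon> \<Longrightarrow> \<epsilon> \<le> \<epsilon>0 \<Longrightarrow>
          0 < \<rho> j (q j - \<epsilon>) \<and> \<rho> j (q j - \<epsilon>) < C \<and> 0 < \<rho> j (q j + \<epsilon>) \<and> \<rho> j (q j + \<epsilon>) < C"
    and \<rho>_left: "\<And>j. j \<in> {1..d} \<Longrightarrow> ((\<lambda>\<epsilon>. \<rho> j (q j - \<epsilon>)) \<longlongrightarrow> \<rho> j (q j)) (at_right 0)"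
    and \<rho>_right: "\<And>j. j \<in> {1..d} \<Longrightarrow> ((\<lambda>\<epsilon>. \<rho> j (q j + \<epsilon>)) \<longlongrightarrow> \<rho> j (q j)) (at_right 0)"
    and \<rho>_between: "\<And>j \<epsilon>. j \<in> {1..d} \<Longrightarrow> 0 < \<epsilon> \<Longrightarrow> \<epsilon> \<le> \<epsilon>0 \<Longrightarrow>
          \<rho> j (q j) \<in> {\<rho> j (q j + \<epsilon>)..\<rho> j (q j - \<epsilon>)}"
    and exp_rate: "\<exists>\<epsilon>>0. \<epsilon> \<le> \<epsilon>0 \<and> (\<lambda>k. exp (- 2 * \<epsilon>\<^sup>2 * real k) / a k) \<longlonglongrightarrow> 0"
    and \<rho>_pos: "\<And>j. j \<in> {1..d} \<Longrightarrow> 0 < \<rho> j (q j)"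
    and g_cont: "continuous_on UNIV g"
    and \<theta>_bounded: "AE \<omega> in M. \<exists>R>0. \<forall>k. \<theta> k \<omega> \<in> ball 0 R"
    and \<beta>_bounded: "AE \<omega> in M. \<exists>R>0. \<forall>k. subvec (S (J k \<omega>)) (\<beta> k (\<theta> k \<omega>) \<omega>) \<in> ball 0 R"
    and \<beta>_lim: "AE \<omega> in M. (\<lambda>k. subvec (S (J k \<omega>)) (\<beta> k (\<theta> k \<omega>) \<omega>)) \<longlonglongrightarrow> 0"
    \<comment> \<open>the supremum may be infinite\<close>
    and noise_sum: "\<And>\<epsilon>::real. \<epsilon> > 0 \<Longrightarrow>
          (\<lambda>k. measure M {\<omega> \<in> space M.
             (SUP m\<in>{k..}. ereal (norm (\<Sum>r=k..m. a r *\<^sub>R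
                ((next_gain aj (\<lambda>i. J i \<omega>) r (J r \<omega>) / a r) *\<^sub>R
                   subvec (S (J r \<omega>)) (\<xi> r (\<theta> r \<omega>) \<omega>))))) \<ge> ereal \<epsilon>}) \<longlonglongrightarrow> 0"
    and stable: "locally_asymptotically_stable
          (\<lambda>z. - (\<Sum>j\<in>{1..d}. (q j * \<rho> j (q j)) *\<^sub>R subvec (S j) (g z))) \<theta>star"
    and A_compact: "compact A"
    and A_DA: "A \<subseteq> domain_of_attraction
          (\<lambda>z. - (\<Sum>j\<in>{1..d}. (q j * \<rho> j (q j)) *\<^sub>R subvec (S j) (g z))) \<theta>star"
    and A_io: "AE \<omega> in M. \<exists>\<^sub>\<infinity>k. \<theta> k \<omega> \<in> A"
  shows "AE \<omega> in M. (\<lambda>k. \<theta> k \<omega>) \<longlonglongrightarrow> \<theta>star"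
proof -
  interpret prob_space M by (fact prob)
  have J: "J k \<in> measurable M (count_space {1..d})" for k
    using J_indep by (simp add: indep_vars_def)
  have a_lim: "a \<longlonglongrightarrow> 0"
    using summable_LIMSEQ_zero[OF a_sqsum] by simp
  define Y where "Y r \<omega> = a r *\<^sub>R ((next_gain aj (\<lambda>i. J i \<omega>) r (J r \<omega>) / a r) *\<^sub>R
      subvec (S (J r \<omega>)) (\<xi> r (\<theta> r \<omega>) \<omega>))" for r \<omega>
  have Ym[measurable]: "Y r \<in> borel_measurable M" for r
  proof -
    have "(\<lambda>\<omega>. ghat r (\<theta> r \<omega>) \<omega>) \<in> borel_measurable M"
      and "(\<lambda>\<omega>. ghat r (\<theta> r \<omega>) \<omega> - \<xi> r (\<theta> r \<omega>) \<omega>) \<in> borel_measurable M"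
      using noise[of r] measurable_from_subalg[OF F_sub[of r]] by (auto simp: is_cond_exp_def)
    from borel_measurable_diff[OF this] have "(\<lambda>\<omega>. \<xi> r (\<theta> r \<omega>) \<omega>) \<in> borel_measurable M" by simp
    from gain_times_subvec_measurable[OF J this] show ?thesis unfolding Y_def .
  qed
  have noise_summable: "AE \<omega> in M. summable (\<lambda>k. Y k \<omega>)"
  proof (rule AE_summable_if_tails_vanish[OF Ym])
    fix \<epsilon> :: real assume \<epsilon>: "\<epsilon> > 0"
    \<comment> \<open>\<open>SUP\<close> is over closed ranges \<open>{k..m}\<close>, so a sum over \<open>{k..<m}\<close> corresponds to index \<open>m - 1\<close>;
      for \<open>m = k\<close> the sum is empty and cannot reach \<open>\<epsilon>\<close>\<close>
    define Q where "Q k = {\<omega> \<in> space M. ereal \<epsilon> \<le> (SUP m\<in>{k..}. ereal (norm (\<Sum>r=k..m. Y r \<omega>)))}" for k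
    have [measurable]: "Q k \<in> sets M" for k
      unfolding Q_def by measurable
    have le: "prob {\<omega> \<in> space M. \<exists>m\<ge>k. \<epsilon> \<le> norm (\<Sum>r=k..<m. Y r \<omega>)} \<le> prob (Q k)" for k
    proof (rule finite_measure_mono)
      show "{\<omega> \<in> space M. \<exists>m\<ge>k. \<epsilon> \<le> norm (\<Sum>r=k..<m. Y r \<omega>)} \<subseteq> Q k"
      proof safe
        fix \<omega> m assume \<omega>: "\<omega> \<in> space M" and m: "k \<le> m" "\<epsilon> \<le> norm (\<Sum>r=k..<m. Y r \<omega>)"
        have "k < m" using m \<epsilon> by (cases "k = m") auto
        then obtain n where n: "m = Suc n" "n \<ge> k" by (cases m) auto
        have "ereal \<epsilon> \<le> ereal (norm (\<Sum>r=k..n. Y r \<omega>))"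
          using m(2) by (simp add: n(1) atLeastLessThanSuc_atLeastAtMost)
        also have "\<dots> \<le> (SUP m\<in>{k..}. ereal (norm (\<Sum>r=k..m. Y r \<omega>)))"
          using n(2) by (intro SUP_upper) auto
        finally show "\<omega> \<in> Q k" using \<omega> by (simp add: Q_def)
      qed
    qed simp
    have "(\<lambda>k. prob (Q k)) \<longlonglongrightarrow> 0"
      using noise_sum[OF \<epsilon>] unfolding Q_def Y_def .
    then show "(\<lambda>k. prob {\<omega> \<in> space M. \<exists>m\<ge>k. \<epsilon> \<le> norm (\<Sum>r=k..<m. Y r \<omega>)}) \<longlonglongrightarrow> 0"
      by (rule Lim_null_comparison[rotated]) (use le in \<open>simp add: always_eventually\<close>)
  qed
  have average: "AE \<omega> in M. \<forall>j\<in>{1..d}. summable (\<lambda>k. a k * (of_bool (J k \<omega> = j) - q j))"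
    by (intro AE_finite_allI AE_selection_average_summable[OF J_indep] J_dist a_sqsum) auto
  have frequency: "AE \<omega> in M. \<forall>j\<in>{1..d}. (\<lambda>n. real (card {i. i < n \<and> J i \<omega> = j}) / real n) \<longlonglongrightarrow> q j"
    by (intro AE_finite_allI AE_selection_frequency[OF J_indep _ a_sqsum] J_dist) auto
  have decomp': "AE \<omega> in M. \<forall>k. ghat k (\<theta> k \<omega>) \<omega> = g (\<theta> k \<omega>) + \<beta> k (\<theta> k \<omega>) \<omega> + \<xi> k (\<theta> k \<omega>) \<omega>"
    by (intro AE_all_countable[THEN iffD2] allI decomp)
  show ?thesis
    using noise_summable average frequency decomp' \<theta>_bounded \<beta>_lim A_io AE_space
  proof eventually_elim
    case (elim \<omega>)
    define c where "c k j = next_gain aj (\<lambda>i. J i \<omega>) k j / a k" for k j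
    have js: "J k \<omega> \<in> {1..d}" for k
      using measurable_space[OF J elim(8)] by simp
    have c_lim: "(\<lambda>k. c k j) \<longlonglongrightarrow> \<rho> j (q j)" if j: "j \<in> {1..d}" for j
      unfolding c_def next_gain_def
    proof (rule gain_ratio_tendsto[where \<delta> = \<epsilon>0 and R = "\<rho> j"])
      show "aj j n \<le> aj j m" if "m \<le> n" for m n
        using aj_decr[OF j, of m n] that by (cases "m = n") auto
    qed (use elim(3) j a_pos \<epsilon>0_pos \<rho>_lower \<rho>_upper \<rho>_left \<rho>_right in auto)
    have bounded: "bounded (range (\<lambda>k. \<theta> k \<omega>))"
    proof -
      from elim(5) obtain R where "range (\<lambda>k. \<theta> k \<omega>) \<subseteq> ball 0 R" by blast
      then show ?thesis using bounded_ball bounded_subset by blast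
    qed
    show ?case
    proof (rule subvec_recursion_tendsto[OF a_pos a_lim a_sum js _ c_lim g_cont bounded elim(6) _ _ stable A_compact A_DA elim(7)])
      show "summable (\<lambda>k. a k * (of_bool (J k \<omega> = j) - q j))" if "j \<in> {1..d}" for j
        using elim(2) that by blast
      show "summable (\<lambda>k. a k *\<^sub>R (c k (J k \<omega>) *\<^sub>R subvec (S (J k \<omega>)) (\<xi> k (\<theta> k \<omega>) \<omega>)))"
        using elim(1) by (simp only: Y_def c_def)
      show "\<theta> (Suc k) \<omega> = \<theta> k \<omega> - (a k * c k (J k \<omega>)) *\<^sub>R
          subvec (S (J k \<omega>)) (g (\<theta> k \<omega>) + \<beta> k (\<theta> k \<omega>) \<omega> + \<xi> k (\<theta> k \<omega>) \<omega>)" for k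
        using algorithm[OF elim(8), of k] elim(4)[rule_format, of k] a_pos[of k] by (simp add: c_def)
    qed
  qed
qed

end
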